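(* Let $g\ge 0$ and $r\ge 1$ be integers. The $L$-tableaux with parameters $(g,r,g+r)$ are in bijection with the $(r+1)$-ary sequences of length $g$, that is, with the sequences of length $g$ with letters from the alphabet $\{0,1,2,\ldots,r\}$.
   Context: Young diagrams are drawn in the French convention (left- and bottom-justified, with the longest row at the bottom). An $L$-tableau with parameters $(g,r,d)$ is a filling of all boxes of a grid with $r+1$ rows and $d-r$ columns (so $g$ columns when $d=g+r$) with "red" and "blue" integers such that: (1) the boxes containing red integers form the Young diagram of a partition placed in the lower left corner of the grid; the red integers weakly increase from bottom to top up columns and strictly increase from left to right across rows; and they consist of the numbers $1,2,\ldots,g$, each occurring exactly $r$ times; (2) the blue integers occupy the remaining boxes of the grid, have values in $\{0,1,\ldots,r\}$ (with any multiplicities), strictly increase from bottom to top up columns, and weakly increase from left to right across rows. There is no order condition between red and blue integers. *)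

theory Defs
  imports Main
begin

text \<open>
  A box of a grid is a pair \<open>(i, j)\<close>: row \<open>i\<close>, counted from the bottom, and column \<open>j\<close>, counted
  from the left, both starting at 0 (French convention).
\<close>

type_synonym box = "nat \<times> nat"

definition is_partition :: "nat list \<Rightarrow> bool" where
  "is_partition ps \<longleftrightarrow> sorted_wrt (\<ge>) ps \<and> 0 \<notin> set ps"

definition young_diagram :: "nat list \<Rightarrow> box set" where
  "young_diagram ps = {(i, j). i < length ps \<and> j < ps ! i}"

datatype entry = Red nat | Blue nat

text \<open>
  A filling is a partial map whose domain is exactly the grid, so that distinct fillings are
  distinct maps. The column count \<open>d - r\<close> is truncated subtraction; the notion is meant for
  \<open>r \<le> d\<close>.
\<close>

definition grid :: "nat \<Rightarrow> nat \<Rightarrow> box set" where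
  "grid r d = {..<r + 1} \<times> {..<d - r}"

definition red_boxes :: "(box \<rightharpoonup> entry) \<Rightarrow> box set" where
  "red_boxes T = {b. \<exists>a. T b = Some (Red a)}"

definition is_L_tableau :: "nat \<Rightarrow> nat \<Rightarrow> nat \<Rightarrow> (box \<rightharpoonup> entry) \<Rightarrow> bool" where
  "is_L_tableau g r d T \<longleftrightarrow>
     dom T = grid r d \<and>
     (\<exists>ps. is_partition ps \<and> red_boxes T = young_diagram ps) \<and>
     (\<forall>i i' j a b. i < i' \<longrightarrow> T (i, j) = Some (Red a) \<longrightarrow> T (i', j) = Some (Red b) \<longrightarrow> a \<le> b) \<and>
     (\<forall>i j j' a b. j < j' \<longrightarrow> T (i, j) = Some (Red a) \<longrightarrow> T (i, j') = Some (Red b) \<longrightarrow> a < b) \<and>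
     (\<forall>x a. T x = Some (Red a) \<longrightarrow> a \<in> {1..g}) \<and>
     (\<forall>a\<in>{1..g}. card {x. T x = Some (Red a)} = r) \<and>
     (\<forall>x a. T x = Some (Blue a) \<longrightarrow> a \<in> {0..r}) \<and>
     (\<forall>i i' j a b. i < i' \<longrightarrow> T (i, j) = Some (Blue a) \<longrightarrow> T (i', j) = Some (Blue b) \<longrightarrow> a < b) \<and>
     (\<forall>i j j' a b. j < j' \<longrightarrow> T (i, j) = Some (Blue a) \<longrightarrow> T (i, j') = Some (Blue b) \<longrightarrow> a \<le> b)"

definition L_tableaux :: "nat \<Rightarrow> nat \<Rightarrow> nat \<Rightarrow> (box \<rightharpoonup> entry) set" where
  "L_tableaux g r d = {T. is_L_tableau g r d T}"

definition words :: "nat \<Rightarrow> nat \<Rightarrow> nat list set" where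
  "words r g = {w. length w = g \<and> set w \<subseteq> {0..r}}"

end

theory Submission
  imports Defs
begin

text \<open>
  There are \<open>(r + 1)^g\<close> words, so it suffices to show that there are equally many tableaux.

  Cut a tableau along the boundary between the two colours. Of the \<open>(r + 1) g\<close> boxes exactly
  \<open>r g\<close> are red, so the numbers \<open>n p\<close> of blue boxes in the rows, read from the top row down,
  form a partition \<open>n\<close> of \<open>g\<close> with at most \<open>r + 1\<close> parts. A half turn together with
  \<open>a \<mapsto> r - a\<close> makes the blue part a semistandard tableau of shape \<open>n\<close> with entries
  \<open>0, \<dots>, r\<close>. As the colours do not interact, the number of tableaux is the sum, over all such
  \<open>n\<close>, of \<open>\<rho> n * \<beta> n\<close>, where \<open>\<rho>\<close> counts the red parts and \<open>\<beta>\<close> the semistandard tableaux.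

  Red: each letter occurs \<open>r\<close> times and at most once in a row, so it misses exactly one of the
  \<open>r + 1\<close> rows. Deleting the letter \<open>g + 1\<close> together with one column of the grid therefore
  takes one cell away from \<open>n\<close>: \<open>\<rho> n\<close> is the sum of \<open>\<rho> n'\<close> over the partitions \<open>n'\<close> that
  arise from \<open>n\<close> by removing a cell (\<open>card_red_fillings_Suc\<close>). So \<open>\<rho> n\<close> is the number of
  standard tableaux of shape \<open>n\<close>.

  Blue: by the Pieri rule for a single cell (\<open>pieri_single_cell\<close>), \<open>(r + 1) * \<beta> n'\<close> is the sum
  of \<open>\<beta> n\<close> over the partitions \<open>n\<close> that arise from \<open>n'\<close> by adding a cell.

  Interchanging the two sums shows that the total for \<open>g + 1\<close> is \<open>r + 1\<close> times the total for
  \<open>g\<close> (\<open>sum_red_times_blue\<close>). This is the identity that the Robinson-Schensted-Knuth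
  correspondence for words proves bijectively; here the Pieri rule replaces row insertion. It is
  derived by deleting the largest entry of a semistandard tableau, which reduces it to the
  commutation of adding one cell with removing a horizontal strip (\<open>interlaces_local_count\<close>).
\<close>

section \<open>Shapes and their cells\<close>

definition cells :: "(nat \<Rightarrow> nat) \<Rightarrow> box set" where
  "cells \<mu> = {(i, j). j < \<mu> i}"

lemma cells_iff [simp]: "(i, j) \<in> cells \<mu> \<longleftrightarrow> j < \<mu> i"
  by (simp add: cells_def)

lemma dom_eq_cells:
  assumes "dom T = cells \<mu>"
  shows "(\<exists>a. T (i, j) = Some a) \<longleftrightarrow> j < \<mu> i" "T (i, j) = None \<longleftrightarrow> \<mu> i \<le> j"
proof -
  show *: "(\<exists>a. T (i, j) = Some a) \<longleftrightarrow> j < \<mu> i"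
    using assms by (metis cells_iff domD domI)
  show "T (i, j) = None \<longleftrightarrow> \<mu> i \<le> j"
    using * by (metis not_le not_None_eq)
qed

text \<open>
  The partitions with at most \<open>N\<close> parts, as antitone functions that vanish from \<open>N\<close> on; unlike
  lists, these allow a cell to be added to a row without a case distinction on the number of parts.
\<close>

definition shapes :: "nat \<Rightarrow> (nat \<Rightarrow> nat) set" where
  "shapes N = {\<mu>. antimono \<mu> \<and> (\<forall>i\<ge>N. \<mu> i = 0)}"

lemma cells_mono: "(\<And>i. \<kappa> i \<le> \<mu> i) \<Longrightarrow> cells \<kappa> \<subseteq> cells \<mu>"
  unfolding cells_def using less_le_trans by blast

lemma cells_inject: "cells \<mu> = cells \<nu> \<longleftrightarrow> \<mu> = \<nu>"
proof
  assume eq: "cells \<mu> = cells \<nu>"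
  have "\<mu> i = \<nu> i" for i
  proof -
    have "j < \<mu> i \<longleftrightarrow> j < \<nu> i" for j
      using eq by (metis cells_iff)
    from this[of "\<mu> i"] this[of "\<nu> i"] show ?thesis
      by linarith
  qed
  then show "\<mu> = \<nu>" by blast
qed simp

lemma cells_eq_Sigma: "\<forall>i\<ge>N. \<mu> i = 0 \<Longrightarrow> cells \<mu> = (SIGMA i:{..<N}. {..<\<mu> i})"
  by (auto simp: cells_def) (metis not_less0 not_le)

lemma finite_cells: "\<forall>i\<ge>N. \<mu> i = 0 \<Longrightarrow> finite (cells \<mu>)"
  by (simp add: cells_eq_Sigma)

lemma card_cells: "\<forall>i\<ge>N. \<mu> i = 0 \<Longrightarrow> card (cells \<mu>) = (\<Sum>i<N. \<mu> i)"
  by (simp add: cells_eq_Sigma)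

lemma shapes_antimono: "\<mu> \<in> shapes N \<Longrightarrow> i \<le> j \<Longrightarrow> \<mu> j \<le> \<mu> i"
  by (auto simp: shapes_def antimono_def)

lemma shapes_zero: "\<mu> \<in> shapes N \<Longrightarrow> N \<le> i \<Longrightarrow> \<mu> i = 0"
  by (auto simp: shapes_def)

lemma finite_bounded_shapes: "finite {\<mu> \<in> shapes N. \<forall>i. \<mu> i \<le> c i}"
proof (rule finite_subset)
  show "{\<mu> \<in> shapes N. \<forall>i. \<mu> i \<le> c i} \<subseteq>
      {\<mu>. \<forall>i. (i \<in> {..<N} \<longrightarrow> \<mu> i \<in> {..Max (c ` {..<N})}) \<and> (i \<notin> {..<N} \<longrightarrow> \<mu> i = 0)}"
  proof (intro subsetI CollectI allI conjI impI)
    fix \<mu> i assume *: "\<mu> \<in> {\<mu> \<in> shapes N. \<forall>i. \<mu> i \<le> c i}" "i \<in> {..<N}"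
    have "c i \<le> Max (c ` {..<N})"
      by (rule Max_ge) (use *(2) in auto)
    with *(1) show "\<mu> i \<in> {..Max (c ` {..<N})}"
      using le_trans by blast
  next
    fix \<mu> i assume "\<mu> \<in> {\<mu> \<in> shapes N. \<forall>i. \<mu> i \<le> c i}" "i \<notin> {..<N}"
    then show "\<mu> i = 0" by (simp add: shapes_def)
  qed
qed (rule finite_set_of_finite_funs; simp)

lemma lower_set_is_cells:
  assumes left: "\<And>i j j'. (i, j') \<in> S \<Longrightarrow> j < j' \<Longrightarrow> (i, j) \<in> S"
    and down: "\<And>i i' j. (i', j) \<in> S \<Longrightarrow> i < i' \<Longrightarrow> (i, j) \<in> S"
    and bound: "S \<subseteq> cells \<mu>"
  obtains \<kappa> where "antimono \<kappa>" "S = cells \<kappa>"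
proof
  define \<kappa> where "\<kappa> = (\<lambda>i. LEAST j. (i, j) \<notin> S)"
  have ex: "\<exists>j. (i, j) \<notin> S" for i
    using bound by (metis cells_iff less_irrefl subsetD)
  have iff: "(i, j) \<in> S \<longleftrightarrow> j < \<kappa> i" for i j
  proof
    assume "(i, j) \<in> S"
    show "j < \<kappa> i"
    proof (rule ccontr)
      assume "\<not> j < \<kappa> i"
      moreover have "(i, \<kappa> i) \<notin> S"
        unfolding \<kappa>_def using ex[of i] by (rule LeastI_ex)
      ultimately show False
        using \<open>(i, j) \<in> S\<close> left[of i j "\<kappa> i"] by (metis linorder_neqE_nat)
    qed
  next
    assume "j < \<kappa> i"
    then show "(i, j) \<in> S"
      unfolding \<kappa>_def using not_less_Least by blast
  qed
  then show "S = cells \<kappa>"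
    by (auto simp: cells_def)
  show "antimono \<kappa>"
  proof (rule antimonoI)
    fix i i' :: nat assume "i \<le> i'"
    then have "j < \<kappa> i'  \<Longrightarrow> j < \<kappa> i" for j
      using down[of i' j i] iff by (metis le_neq_implies_less)
    from this[of "\<kappa> i"] show "\<kappa> i' \<le> \<kappa> i"
      by linarith
  qed
qed

section \<open>Deleting the largest entry of a filling\<close>

definition below :: "nat \<Rightarrow> (box \<rightharpoonup> nat) \<Rightarrow> (box \<rightharpoonup> nat)" where
  "below c T = (\<lambda>x. case T x of None \<Rightarrow> None | Some a \<Rightarrow> if a < c then Some a else None)"

definition fill :: "box set \<Rightarrow> nat \<Rightarrow> (box \<rightharpoonup> nat) \<Rightarrow> (box \<rightharpoonup> nat)" where
  "fill D c T = (\<lambda>x. if x \<in> D then (case T x of None \<Rightarrow> Some c | Some a \<Rightarrow> Some a) else None)"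

lemma below_eq_Some: "below c T x = Some a \<longleftrightarrow> T x = Some a \<and> a < c"
  by (auto simp: below_def split: option.splits)

lemma fill_eq_Some:
  "dom T \<subseteq> D \<Longrightarrow> fill D c T x = Some a \<longleftrightarrow> T x = Some a \<or> (T x = None \<and> x \<in> D \<and> a = c)"
  by (auto simp: fill_def split: option.splits)

lemma dom_fill: "dom (fill D c T) = D"
  by (auto simp: fill_def dom_def split: option.splits)

lemma fill_below: "ran T \<subseteq> {..c} \<Longrightarrow> fill (dom T) c (below c T) = T"
  by (rule ext) (force simp: fill_def below_def ran_def split: option.splits)

lemma below_fill: "dom T \<subseteq> D \<Longrightarrow> ran T \<subseteq> {..<c} \<Longrightarrow> below c (fill D c T) = T"
  by (rule ext) (auto simp: fill_def below_def ran_def dom_def split: option.splits)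

text \<open>
  The entries less than \<open>c\<close> of a weakly increasing filling occupy a set of cells that is closed
  towards the corner, and such a set is again a shape.
\<close>

lemma dom_below_is_cells:
  assumes dom: "dom T = cells \<mu>" and "antimono \<mu>"
    and col: "\<And>i i' j a b. i < i' \<Longrightarrow> T (i, j) = Some a \<Longrightarrow> T (i', j) = Some b \<Longrightarrow> a \<le> b"
    and row: "\<And>i j j' a b. j < j' \<Longrightarrow> T (i, j) = Some a \<Longrightarrow> T (i, j') = Some b \<Longrightarrow> a \<le> b"
  obtains \<kappa> where "antimono \<kappa>" "dom (below c T) = cells \<kappa>"
    and "\<And>i j. j < \<kappa> i \<longleftrightarrow> (\<exists>a<c. T (i, j) = Some a)"
proof -
  define S where "S = dom (below c T)"
  have S: "(i, j) \<in> S \<longleftrightarrow> (\<exists>a<c. T (i, j) = Some a)" for i j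
    by (auto simp: S_def dom_def below_eq_Some)
  obtain \<kappa> where \<kappa>: "antimono \<kappa>" "S = cells \<kappa>"
  proof (rule lower_set_is_cells[of S \<mu>])
    fix i j j' assume *: "(i, j') \<in> S" "j < j'"
    obtain b where b: "b < c" "T (i, j') = Some b"
      using *(1) S by blast
    then obtain a where a: "T (i, j) = Some a"
      using dom_eq_cells(1)[OF dom] *(2) less_trans by metis
    from row[OF *(2) a b(2)] a b(1) show "(i, j) \<in> S"
      unfolding S by auto
  next
    fix i i' j assume *: "(i', j) \<in> S" "i < i'"
    obtain b where b: "b < c" "T (i', j) = Some b"
      using *(1) S by blast
    have "\<mu> i' \<le> \<mu> i"
      using \<open>antimono \<mu>\<close> *(2) by (simp add: antimono_def)
    then obtain a where a: "T (i, j) = Some a"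
      using dom_eq_cells(1)[OF dom] b(2) less_le_trans by metis
    from col[OF *(2) a b(2)] a b(1) show "(i, j) \<in> S"
      unfolding S by auto
  next
    show "S \<subseteq> cells \<mu>"
      unfolding S_def dom[symmetric] by (auto simp: below_eq_Some)
  qed blast
  from that[OF \<kappa>(1)] \<kappa>(2) S show ?thesis
    by (simp add: S_def)
qed

text \<open>
  Deleting the largest entry \<open>c\<close> is undone by filling the vacated cells with \<open>c\<close>, so a
  filling of known domain is determined by what remains. The domain \<open>E k\<close> of the remainder
  identifies the class \<open>B k\<close> in which it lies. Both the blue and the red recursion are
  instances.
\<close>

lemma card_by_largest_entry:
  fixes A :: "(box \<rightharpoonup> nat) set"
  assumes A: "\<And>T. T \<in> A \<Longrightarrow> dom T = D \<and> ran T \<subseteq> {..c}"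
    and B: "\<And>k T. k \<in> K \<Longrightarrow> T \<in> B k \<Longrightarrow> dom T = E k \<and> ran T \<subseteq> {..<c}"
    and E: "\<And>k. k \<in> K \<Longrightarrow> E k \<subseteq> D" "inj_on E K"
    and fin: "finite K" "\<And>k. k \<in> K \<Longrightarrow> finite (B k)"
    and remove: "\<And>T. T \<in> A \<Longrightarrow> \<exists>k\<in>K. below c T \<in> B k"
    and add: "\<And>k T. k \<in> K \<Longrightarrow> T \<in> B k \<Longrightarrow> fill D c T \<in> A"
  shows "card A = (\<Sum>k\<in>K. card (B k))"
proof -
  have "bij_betw (below c) A (\<Union>k\<in>K. B k)"
  proof (rule bij_betw_byWitness[where f' = "fill D c"])
    show "\<forall>T\<in>A. fill D c (below c T) = T"
      using A fill_below by metis
    show "\<forall>T\<in>\<Union>k\<in>K. B k. below c (fill D c T) = T"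
      using B E(1) below_fill by (metis UN_E)
  qed (use remove add in auto)
  then have "card A = card (\<Union>k\<in>K. B k)"
    by (rule bij_betw_same_card)
  also have "\<dots> = (\<Sum>k\<in>K. card (B k))"
  proof (rule card_UN_disjoint)
    show "\<forall>k\<in>K. \<forall>l\<in>K. k \<noteq> l \<longrightarrow> B k \<inter> B l = {}"
      using B inj_onD[OF E(2)] by (metis disjoint_iff)
  qed (use fin in auto)
  finally show ?thesis .
qed

section \<open>Semistandard tableaux and interlacing shapes\<close>

definition ssyt :: "nat \<Rightarrow> (nat \<Rightarrow> nat) \<Rightarrow> (box \<rightharpoonup> nat) set" where
  "ssyt N \<mu> = {T. dom T = cells \<mu> \<and> ran T \<subseteq> {..<N} \<and>
     (\<forall>i i' j a b. i < i' \<longrightarrow> T (i, j) = Some a \<longrightarrow> T (i', j) = Some b \<longrightarrow> a < b) \<and>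
     (\<forall>i j j' a b. j < j' \<longrightarrow> T (i, j) = Some a \<longrightarrow> T (i, j') = Some b \<longrightarrow> a \<le> b)}"

lemma ssytD:
  assumes "T \<in> ssyt N \<mu>"
  shows "dom T = cells \<mu>" "ran T \<subseteq> {..<N}"
    and "T x = Some a \<Longrightarrow> a < N"
    and "i < i' \<Longrightarrow> T (i, j) = Some a \<Longrightarrow> T (i', j) = Some b \<Longrightarrow> a < b"
    and "j < j' \<Longrightarrow> T (i, j) = Some a \<Longrightarrow> T (i, j') = Some b \<Longrightarrow> a \<le> b"
proof -
  have *: "dom T = cells \<mu> \<and> ran T \<subseteq> {..<N} \<and>
     (\<forall>i i' j a b. i < i' \<longrightarrow> T (i, j) = Some a \<longrightarrow> T (i', j) = Some b \<longrightarrow> a < b) \<and>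
     (\<forall>i j j' a b. j < j' \<longrightarrow> T (i, j) = Some a \<longrightarrow> T (i, j') = Some b \<longrightarrow> a \<le> b)"
    using assms unfolding ssyt_def by (rule CollectD)
  note c = conjunct1[OF *] conjunct1[OF conjunct2[OF *]] conjunct1[OF conjunct2[OF conjunct2[OF *]]]
    conjunct2[OF conjunct2[OF conjunct2[OF *]]]
  show "dom T = cells \<mu>" "ran T \<subseteq> {..<N}"
    by (fact c)+
  show "T x = Some a \<Longrightarrow> a < N"
    using c(2) ranI[of T x a] by auto
  show "i < i' \<Longrightarrow> T (i, j) = Some a \<Longrightarrow> T (i', j) = Some b \<Longrightarrow> a < b"
    by (rule c(3)[rule_format])
  show "j < j' \<Longrightarrow> T (i, j) = Some a \<Longrightarrow> T (i, j') = Some b \<Longrightarrow> a \<le> b"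
    by (rule c(4)[rule_format])
qed

lemma finite_ssyt:
  assumes "\<mu> \<in> shapes M"
  shows "finite (ssyt N \<mu>)"
proof (rule finite_subset)
  show "ssyt N \<mu> \<subseteq> {T. dom T = cells \<mu> \<and> ran T \<subseteq> {..<N}}"
    using ssytD(1,2) by blast
  have "finite (cells \<mu>)"
    by (rule finite_cells[of M]) (use assms in \<open>simp add: shapes_def\<close>)
  then show "finite {T. dom T = cells \<mu> \<and> ran T \<subseteq> {..<N}}"
    by (rule finite_set_of_finite_maps) simp
qed

text \<open>
  Columns increase strictly, starting from at least \<open>0\<close>. This is why a shape that is filled with
  entries less than \<open>N\<close> has at most \<open>N\<close> rows.
\<close>

lemma ssyt_row_le_entry:
  assumes "T \<in> ssyt N \<mu>" "antimono \<mu>" "T (i, j) = Some a"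
  shows "i \<le> a"
  using assms(3)
proof (induction i arbitrary: a)
  case (Suc i)
  have "j < \<mu> (Suc i)"
    using dom_eq_cells(1)[OF ssytD(1)[OF assms(1)]] Suc.prems by blast
  also have "\<mu> (Suc i) \<le> \<mu> i"
    using assms(2) by (simp add: antimono_def)
  finally obtain b where b: "T (i, j) = Some b"
    using dom_eq_cells(1)[OF ssytD(1)[OF assms(1)]] by blast
  with Suc.IH have "i \<le> b" by blast
  also have "b < a"
    using ssytD(4)[OF assms(1) _ b Suc.prems] by simp
  finally show ?case by simp
qed simp

text \<open>
  For partitions this says that \<open>\<kappa>\<close> lies inside \<open>\<mu>\<close> and that the cells of \<open>\<mu>\<close> outside
  \<open>\<kappa>\<close> form a horizontal strip, that is, no two of them lie in one column.
\<close>

definition interlaces :: "(nat \<Rightarrow> nat) \<Rightarrow> (nat \<Rightarrow> nat) \<Rightarrow> bool" where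
  "interlaces \<kappa> \<mu> \<longleftrightarrow> (\<forall>i. \<mu> (Suc i) \<le> \<kappa> i \<and> \<kappa> i \<le> \<mu> i)"

lemma interlaces_antimono:
  assumes "interlaces \<kappa> \<mu>"
  shows "antimono \<kappa>" "antimono \<mu>"
proof -
  have "\<mu> (Suc i) \<le> \<kappa> i" "\<kappa> i \<le> \<mu> i" for i
    using assms by (simp_all add: interlaces_def)
  then show "antimono \<kappa>" "antimono \<mu>"
    unfolding antimono_iff_le_Suc using le_trans by blast+
qed

lemma finite_interlacing: "finite {\<kappa> \<in> shapes N. interlaces \<kappa> \<mu>}"
  by (rule finite_subset[OF _ finite_bounded_shapes[of N \<mu>]]) (auto simp: interlaces_def)

text \<open>
  The branching rule: the cells with the largest entry \<open>N\<close> form a horizontal strip, because a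
  column contains at most one of them, and every horizontal strip at the outer rim may be filled
  with \<open>N\<close>.
\<close>

lemma card_ssyt_Suc:
  assumes \<mu>: "\<mu> \<in> shapes (Suc N)"
  shows "card (ssyt (Suc N) \<mu>) = (\<Sum>\<kappa> | \<kappa> \<in> shapes N \<and> interlaces \<kappa> \<mu>. card (ssyt N \<kappa>))"
proof (rule card_by_largest_entry[where D = "cells \<mu>" and E = cells and c = N])
  show "finite {\<kappa> \<in> shapes N. interlaces \<kappa> \<mu>}"
    by (rule finite_interlacing)
next
  fix T assume T: "T \<in> ssyt (Suc N) \<mu>"
  have dom: "(\<exists>a. T (i, j) = Some a) \<longleftrightarrow> j < \<mu> i" for i j
    using dom_eq_cells(1)[OF ssytD(1)[OF T]] .
  have le: "T x = Some a \<Longrightarrow> a \<le> N" for x a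
    using ssytD(3)[OF T, of x a] by simp
  have col: "i < i' \<Longrightarrow> T (i, j) = Some a \<Longrightarrow> T (i', j) = Some b \<Longrightarrow> a < b" for i i' j a b
    using ssytD(4)[OF T] .
  have row: "j < j' \<Longrightarrow> T (i, j) = Some a \<Longrightarrow> T (i, j') = Some b \<Longrightarrow> a \<le> b" for i j j' a b
    using ssytD(5)[OF T] .
  obtain \<kappa> where \<kappa>: "antimono \<kappa>" "dom (below N T) = cells \<kappa>"
    and inS: "\<And>i j. j < \<kappa> i \<longleftrightarrow> (\<exists>a<N. T (i, j) = Some a)"
  proof (rule dom_below_is_cells[of T \<mu> N])
    show "antimono \<mu>"
      using \<mu> by (simp add: shapes_def)
    show "dom T = cells \<mu>"
      by (rule ssytD(1)[OF T])
  qed (use less_imp_le[OF col] row in blast)+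
  have "interlaces \<kappa> \<mu>"
    unfolding interlaces_def
  proof (intro allI conjI)
    fix i
    show "\<kappa> i \<le> \<mu> i"
      using inS[of "\<mu> i" i] dom[of i "\<mu> i"] by (auto simp: not_less)
    show "\<mu> (Suc i) \<le> \<kappa> i"
    proof (rule ccontr)
      assume *: "\<not> \<mu> (Suc i) \<le> \<kappa> i"
      then obtain b where b: "T (Suc i, \<kappa> i) = Some b"
        using dom[of "Suc i" "\<kappa> i"] by auto
      have "\<kappa> i < \<mu> i"
        using * shapes_antimono[OF \<mu>, of i "Suc i"] by simp
      then obtain a where a: "T (i, \<kappa> i) = Some a"
        using dom by blast
      have "a < N"
        using col[OF _ a b] le[OF b] by simp
      with a inS[of "\<kappa> i" i] show False by simp
    qed
  qed
  moreover have "\<kappa> i = 0" if "N \<le> i" for i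
  proof (rule ccontr)
    assume "\<kappa> i \<noteq> 0"
    then obtain a where "a < N" "T (i, 0) = Some a"
      using inS[of 0 i] by auto
    then show False
      using ssyt_row_le_entry[OF T, of i 0 a] \<mu> that by (auto simp: shapes_def)
  qed
  ultimately have "\<kappa> \<in> {\<kappa> \<in> shapes N. interlaces \<kappa> \<mu>}"
    using \<kappa>(1) by (simp add: shapes_def)
  moreover have "below N T \<in> ssyt N \<kappa>"
    unfolding ssyt_def mem_Collect_eq below_eq_Some
  proof (intro conjI allI impI)
    show "dom (below N T) = cells \<kappa>"
      by (rule \<kappa>(2))
    show "ran (below N T) \<subseteq> {..<N}"
      by (auto simp: ran_def below_eq_Some)
  qed (use row col in blast)+
  ultimately show "\<exists>\<kappa>\<in>{\<kappa> \<in> shapes N. interlaces \<kappa> \<mu>}. below N T \<in> ssyt N \<kappa>"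
    by blast
next
  fix \<kappa> T assume "\<kappa> \<in> {\<kappa> \<in> shapes N. interlaces \<kappa> \<mu>}" and T: "T \<in> ssyt N \<kappa>"
  then have inter: "\<mu> (Suc i) \<le> \<kappa> i" "\<kappa> i \<le> \<mu> i" for i
    by (auto simp: interlaces_def)
  have dom: "T (i, j) = None \<longleftrightarrow> \<kappa> i \<le> j" for i j
    using dom_eq_cells(2)[OF ssytD(1)[OF T]] .
  have less: "T x = Some a \<Longrightarrow> a < N" for x a
    using ssytD(3)[OF T, of x a] by simp
  have col: "i < i' \<Longrightarrow> T (i, j) = Some a \<Longrightarrow> T (i', j) = Some b \<Longrightarrow> a < b" for i i' j a b
    using ssytD(4)[OF T] .
  have row: "j < j' \<Longrightarrow> T (i, j) = Some a \<Longrightarrow> T (i, j') = Some b \<Longrightarrow> a \<le> b" for i j j' a b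
    using ssytD(5)[OF T] .
  have sub: "dom T \<subseteq> cells \<mu>"
    using ssytD(1)[OF T] cells_mono[of \<kappa> \<mu>] inter(2) by simp
  have short: "j < \<kappa> i" if "i < i'" "j < \<mu> i'" for i i' j
  proof -
    have "\<mu> i' \<le> \<mu> (Suc i)"
      using that(1) by (intro shapes_antimono[OF \<mu>]) simp
    with inter(1)[of i] that(2) show ?thesis by linarith
  qed
  show "fill (cells \<mu>) N T \<in> ssyt (Suc N) \<mu>"
    unfolding ssyt_def mem_Collect_eq dom_fill fill_eq_Some[OF sub]
  proof (intro conjI allI impI)
    show "ran (fill (cells \<mu>) N T) \<subseteq> {..<Suc N}"
      unfolding ran_def fill_eq_Some[OF sub] using less less_SucI by blast
  next
    fix i i' j a b
    assume "i < i'"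
      "T (i, j) = Some a \<or> T (i, j) = None \<and> (i, j) \<in> cells \<mu> \<and> a = N"
      "T (i', j) = Some b \<or> T (i', j) = None \<and> (i', j) \<in> cells \<mu> \<and> b = N"
    then have ij: "T (i, j) = Some a \<or> T (i, j) = None \<and> a = N"
      and i'j: "T (i', j) = Some b \<or> T (i', j) = None \<and> b = N" and "j < \<mu> i'"
      using dom_eq_cells(1)[OF ssytD(1)[OF T], of i' j] inter(2)[of i'] by auto
    then obtain a' where a': "T (i, j) = Some a'"
      using short[OF \<open>i < i'\<close>] dom[of i j] by fastforce
    with ij have "T (i, j) = Some a" by simp
    with i'j show "a < b"
      using col[OF \<open>i < i'\<close>] less by blast
  next
    fix i j j' a b
    assume "j < j'"
      "T (i, j) = Some a \<or> T (i, j) = None \<and> (i, j) \<in> cells \<mu> \<and> a = N"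
      "T (i, j') = Some b \<or> T (i, j') = None \<and> (i, j') \<in> cells \<mu> \<and> b = N"
    moreover have "T (i, j') = None" if "T (i, j) = None"
      using dom[of i j] dom[of i j'] that \<open>j < j'\<close> by simp
    ultimately show "a \<le> b"
      using row[of j j' i a b] less[of "(i, j)" a] by (elim disjE conjE) simp_all
  qed (rule refl)
next
  show "inj_on cells {\<kappa> \<in> shapes N. interlaces \<kappa> \<mu>}"
    by (simp add: inj_on_def cells_inject)
next
  show "cells \<kappa> \<subseteq> cells \<mu>" if "\<kappa> \<in> {\<kappa> \<in> shapes N. interlaces \<kappa> \<mu>}" for \<kappa>
    using that cells_mono[of \<kappa> \<mu>] by (simp add: interlaces_def)
next
  show "finite (ssyt N \<kappa>)" if "\<kappa> \<in> {\<kappa> \<in> shapes N. interlaces \<kappa> \<mu>}" for \<kappa>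
    using that finite_ssyt by blast
next
  show "dom T = cells \<mu> \<and> ran T \<subseteq> {..N}" if "T \<in> ssyt (Suc N) \<mu>" for T
    using ssytD(1,2)[OF that] by auto
next
  show "dom T = cells \<kappa> \<and> ran T \<subseteq> {..<N}" if "T \<in> ssyt N \<kappa>" for \<kappa> T
    using ssytD(1,2)[OF that] by auto
qed

lemma card_ssyt_zero_shape: "card (ssyt N (\<lambda>_. 0)) = 1"
proof -
  have "ssyt N (\<lambda>_. 0) = {Map.empty}"
    by (auto simp: ssyt_def cells_def)
  then show ?thesis by simp
qed

section \<open>The Pieri rule for a single cell\<close>

abbreviation add_cell :: "nat \<Rightarrow> (nat \<Rightarrow> nat) \<Rightarrow> (nat \<Rightarrow> nat)" where
  "add_cell p \<mu> \<equiv> \<mu>(p := Suc (\<mu> p))"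

abbreviation remove_cell :: "nat \<Rightarrow> (nat \<Rightarrow> nat) \<Rightarrow> (nat \<Rightarrow> nat)" where
  "remove_cell p \<mu> \<equiv> \<mu>(p := \<mu> p - 1)"

text \<open>
  The operators \<open>U\<close> (add a cell) and \<open>D\<close> (remove a horizontal strip) on shapes satisfy
  \<open>D U = U D + D\<close>; here the coefficients of \<open>\<kappa>\<close> in the images of \<open>\<mu>\<close> are compared.

  If \<open>\<kappa>\<close> interlaces \<open>\<mu>\<close>, removing a cell from row \<open>p\<close> of \<open>\<kappa>\<close> preserves this exactly when
  adding one to row \<open>p + 1\<close> of \<open>\<mu>\<close> does, both meaning \<open>\<mu> (p + 1) < \<kappa> p\<close>; and row \<open>0\<close> of
  \<open>\<mu>\<close> can always grow, which gives the extra term. Otherwise, either operation on row \<open>p\<close> restores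
  interlacing just in case the only inequality that fails is \<open>\<kappa> p \<le> \<mu> p\<close>, and that by one.
\<close>

lemma interlaces_local_count:
  assumes \<kappa>: "\<kappa> \<in> shapes N" and \<mu>: "\<mu> \<in> shapes (Suc N)"
  shows "card {p. p < Suc N \<and> interlaces \<kappa> (add_cell p \<mu>)} =
    card {p. p < N \<and> 0 < \<kappa> p \<and> interlaces (remove_cell p \<kappa>) \<mu>} + (if interlaces \<kappa> \<mu> then 1 else 0)"
proof (cases "interlaces \<kappa> \<mu>")
  case True
  then have inter: "\<mu> (Suc i) \<le> \<kappa> i" "\<kappa> i \<le> \<mu> i" for i
    by (auto simp: interlaces_def)
  define C where "C = {p. p < N \<and> \<mu> (Suc p) < \<kappa> p}"
  have R: "{p. p < N \<and> 0 < \<kappa> p \<and> interlaces (remove_cell p \<kappa>) \<mu>} = C"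
  proof (intro set_eqI iffI)
    fix p assume *: "p \<in> {p. p < N \<and> 0 < \<kappa> p \<and> interlaces (remove_cell p \<kappa>) \<mu>}"
    then have "\<mu> (Suc p) \<le> \<kappa> p - 1"
      unfolding interlaces_def by (auto dest: spec[of _ p])
    with * show "p \<in> C" by (auto simp: C_def)
  next
    fix p assume "p \<in> C"
    then show "p \<in> {p. p < N \<and> 0 < \<kappa> p \<and> interlaces (remove_cell p \<kappa>) \<mu>}"
      using inter by (auto simp: interlaces_def C_def intro: le_trans[OF diff_le_self])
  qed
  have "{p. p < Suc N \<and> interlaces \<kappa> (add_cell p \<mu>)} = insert 0 (Suc ` C)"
  proof (intro set_eqI iffI)
    fix p assume "p \<in> {p. p < Suc N \<and> interlaces \<kappa> (add_cell p \<mu>)}"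
    then have p: "p < Suc N" "interlaces \<kappa> (add_cell p \<mu>)" by auto
    show "p \<in> insert 0 (Suc ` C)"
    proof (cases p)
      case (Suc q)
      then have "Suc (\<mu> p) \<le> \<kappa> q"
        using p(2) unfolding interlaces_def by (auto dest: spec[of _ q])
      with p(1) Suc show ?thesis by (auto simp: C_def)
    qed simp
  next
    fix p assume "p \<in> insert 0 (Suc ` C)"
    then show "p \<in> {p. p < Suc N \<and> interlaces \<kappa> (add_cell p \<mu>)}"
      using inter by (auto simp: interlaces_def C_def intro: le_SucI)
  qed
  moreover have "finite C" by (simp add: C_def)
  ultimately show ?thesis
    using True R by (simp add: card_image)
next
  case False
  have "{p. p < Suc N \<and> interlaces \<kappa> (add_cell p \<mu>)} =
      {p. p < N \<and> 0 < \<kappa> p \<and> interlaces (remove_cell p \<kappa>) \<mu>}"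
  proof (intro set_eqI iffI)
    fix p assume "p \<in> {p. p < Suc N \<and> interlaces \<kappa> (add_cell p \<mu>)}"
    then have inter: "(add_cell p \<mu>) (Suc i) \<le> \<kappa> i" "\<kappa> i \<le> (add_cell p \<mu>) i" for i
      by (auto simp: interlaces_def)
    have low: "\<mu> (Suc i) \<le> \<kappa> i" for i
      using inter(1)[of i] by (auto split: if_splits)
    have high: "\<kappa> i \<le> \<mu> i" if "i \<noteq> p" for i
      using inter(2)[of i] that by auto
    have p: "\<kappa> p = Suc (\<mu> p)"
    proof (rule ccontr)
      assume "\<kappa> p \<noteq> Suc (\<mu> p)"
      then have "\<kappa> p \<le> \<mu> p"
        using inter(2)[of p] by simp
      with low high have "interlaces \<kappa> \<mu>"
        unfolding interlaces_def by metis
      with False show False ..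
    qed
    have "p < N"
      using p shapes_zero[OF \<kappa>, of p] by (metis not_less nat.distinct(1))
    moreover have "interlaces (remove_cell p \<kappa>) \<mu>"
      using p low high shapes_antimono[OF \<mu>, of p "Suc p"] by (auto simp: interlaces_def)
    ultimately show "p \<in> {p. p < N \<and> 0 < \<kappa> p \<and> interlaces (remove_cell p \<kappa>) \<mu>}"
      using p by simp
  next
    fix p assume "p \<in> {p. p < N \<and> 0 < \<kappa> p \<and> interlaces (remove_cell p \<kappa>) \<mu>}"
    then have "p < N" "0 < \<kappa> p" and
      inter: "\<mu> (Suc i) \<le> (remove_cell p \<kappa>) i" "(remove_cell p \<kappa>) i \<le> \<mu> i" for i
      by (auto simp: interlaces_def)
    have low: "\<mu> (Suc i) \<le> \<kappa> i" for i
      using inter(1)[of i] by (auto split: if_splits)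
    have high: "\<kappa> i \<le> \<mu> i" if "i \<noteq> p" for i
      using inter(2)[of i] that by auto
    have p: "\<kappa> p = Suc (\<mu> p)"
    proof (rule ccontr)
      assume "\<kappa> p \<noteq> Suc (\<mu> p)"
      then have "\<kappa> p \<le> \<mu> p"
        using inter(2)[of p] by simp
      with low high have "interlaces \<kappa> \<mu>"
        unfolding interlaces_def by metis
      with False show False ..
    qed
    have "interlaces \<kappa> (add_cell p \<mu>)"
      unfolding interlaces_def
    proof (intro allI conjI)
      fix i
      show "\<kappa> i \<le> (add_cell p \<mu>) i"
        using p high by auto
      show "(add_cell p \<mu>) (Suc i) \<le> \<kappa> i"
        using p low[of i] shapes_antimono[OF \<kappa>, of i "Suc i"] by auto
    qed
    with \<open>p < N\<close> show "p \<in> {p. p < Suc N \<and> interlaces \<kappa> (add_cell p \<mu>)}"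
      by simp
  qed
  with False show ?thesis by simp
qed



lemma sum_over_added_cells:
  "(\<Sum>\<nu> | \<nu> \<in> shapes N \<and> (\<exists>p. \<nu> = add_cell p \<mu>). f \<nu>) =
    (\<Sum>p | p < N \<and> add_cell p \<mu> \<in> shapes N. f (add_cell p \<mu>))"
proof -
  have "{\<nu>. \<nu> \<in> shapes N \<and> (\<exists>p. \<nu> = add_cell p \<mu>)} =
      (\<lambda>p. add_cell p \<mu>) ` {p. p < N \<and> add_cell p \<mu> \<in> shapes N}"
  proof (intro set_eqI iffI)
    fix \<nu> assume "\<nu> \<in> {\<nu>. \<nu> \<in> shapes N \<and> (\<exists>p. \<nu> = add_cell p \<mu>)}"
    then obtain p where p: "add_cell p \<mu> \<in> shapes N" "\<nu> = add_cell p \<mu>" by blast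
    then have "p < N"
      using shapes_zero[OF p(1), of p] by (metis fun_upd_same nat.distinct(1) not_le)
    with p show "\<nu> \<in> (\<lambda>p. add_cell p \<mu>) ` {p. p < N \<and> add_cell p \<mu> \<in> shapes N}" by blast
  qed blast
  moreover have "inj (\<lambda>p. add_cell p \<mu>)"
    by (rule injI) (metis fun_upd_apply n_not_Suc_n)
  ultimately show ?thesis
    by (simp add: sum.reindex inj_on_subset)
qed

text \<open>
  Induction on the number \<open>N\<close> of letters. The branching rule turns the left side into a sum
  over \<open>\<kappa>\<close> weighted by the number of ways to go up from \<open>\<mu>\<close> and down to \<open>\<kappa>\<close>. The local
  commutation rule trades these for the ways to go down first and then up, which the induction
  hypothesis counts as \<open>N\<close>, and one further way down for the additional letter.
\<close>

lemma pieri_single_cell: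
  assumes "\<mu> \<in> shapes N"
  shows "(\<Sum>\<nu> | \<nu> \<in> shapes N \<and> (\<exists>p. \<nu> = add_cell p \<mu>). card (ssyt N \<nu>)) = N * card (ssyt N \<mu>)"
  using assms
proof (induction N arbitrary: \<mu>)
  case 0
  show ?case unfolding sum_over_added_cells by simp
next
  case (Suc N)
  \<comment> \<open>A finite set that contains every shape reachable by going up and down from \<open>\<mu>\<close>, in either order.\<close>
  define K where "K = {\<kappa> \<in> shapes N. \<forall>i. \<kappa> i \<le> Suc (\<mu> i)}"
  define R where "R = {\<rho> \<in> shapes N. interlaces \<rho> \<mu>}"
  define P where "P \<rho> = {p. p < N \<and> add_cell p \<rho> \<in> shapes N}" for \<rho>
  define Q where "Q \<kappa> = {p. p < N \<and> 0 < \<kappa> p \<and> interlaces (remove_cell p \<kappa>) \<mu>}" for \<kappa>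
  define b where "b \<kappa> = card (ssyt N \<kappa>)" for \<kappa>
  have finK: "finite K"
    unfolding K_def by (rule finite_bounded_shapes)
  have finR: "finite R"
    unfolding R_def by (rule finite_interlacing)
  have RK: "R \<subseteq> K"
    unfolding R_def K_def interlaces_def using le_SucI by blast

  have "(\<Sum>\<nu> | \<nu> \<in> shapes (Suc N) \<and> (\<exists>p. \<nu> = add_cell p \<mu>). card (ssyt (Suc N) \<nu>)) =
      (\<Sum>p | p < Suc N \<and> add_cell p \<mu> \<in> shapes (Suc N).
        \<Sum>\<kappa> | \<kappa> \<in> shapes N \<and> interlaces \<kappa> (add_cell p \<mu>). b \<kappa>)"
    unfolding sum_over_added_cells b_def by (intro sum.cong refl card_ssyt_Suc) simp
  \<comment> \<open>If adding a cell in row \<open>p\<close> does not give a partition, nothing interlaces the result.\<close>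
  also have "\<dots> = (\<Sum>p<Suc N. \<Sum>\<kappa> | \<kappa> \<in> K \<and> interlaces \<kappa> (add_cell p \<mu>). b \<kappa>)"
  proof (rule sum.mono_neutral_cong_left)
    show "\<forall>p\<in>{..<Suc N} - {p. p < Suc N \<and> add_cell p \<mu> \<in> shapes (Suc N)}.
        (\<Sum>\<kappa> | \<kappa> \<in> K \<and> interlaces \<kappa> (add_cell p \<mu>). b \<kappa>) = 0"
    proof
      fix p assume p: "p \<in> {..<Suc N} - {p. p < Suc N \<and> add_cell p \<mu> \<in> shapes (Suc N)}"
      have "\<not> antimono (add_cell p \<mu>)"
        using p Suc.prems by (auto simp: shapes_def)
      then have "{\<kappa>. \<kappa> \<in> K \<and> interlaces \<kappa> (add_cell p \<mu>)} = {}"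
        using interlaces_antimono(2) by blast
      then show "(\<Sum>\<kappa> | \<kappa> \<in> K \<and> interlaces \<kappa> (add_cell p \<mu>). b \<kappa>) = 0"
        by (simp only: sum.empty)
    qed
  next
    fix p
    have "\<kappa> i \<le> Suc (\<mu> i)" if "interlaces \<kappa> (add_cell p \<mu>)" for \<kappa> i
    proof -
      have "\<kappa> i \<le> (add_cell p \<mu>) i"
        using that unfolding interlaces_def by blast
      then show ?thesis by (cases "i = p") auto
    qed
    then have "{\<kappa>. \<kappa> \<in> shapes N \<and> interlaces \<kappa> (add_cell p \<mu>)} =
        {\<kappa>. \<kappa> \<in> K \<and> interlaces \<kappa> (add_cell p \<mu>)}"
      unfolding K_def by blast
    then show "(\<Sum>\<kappa> | \<kappa> \<in> shapes N \<and> interlaces \<kappa> (add_cell p \<mu>). b \<kappa>) =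
        (\<Sum>\<kappa> | \<kappa> \<in> K \<and> interlaces \<kappa> (add_cell p \<mu>). b \<kappa>)"
      by (simp only:)
  qed auto
  also have "\<dots> = (\<Sum>\<kappa>\<in>K. \<Sum>p | p \<in> {..<Suc N} \<and> interlaces \<kappa> (add_cell p \<mu>). b \<kappa>)"
    by (rule sum.swap_restrict) (use finK in auto)
  also have "\<dots> = (\<Sum>\<kappa>\<in>K. (card (Q \<kappa>) + (if interlaces \<kappa> \<mu> then 1 else 0)) * b \<kappa>)"
  proof (rule sum.cong)
    fix \<kappa> assume "\<kappa> \<in> K"
    then have "card {p. p < Suc N \<and> interlaces \<kappa> (add_cell p \<mu>)} =
        card (Q \<kappa>) + (if interlaces \<kappa> \<mu> then 1 else 0)"
      unfolding Q_def K_def by (intro interlaces_local_count) (use Suc.prems in auto)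
    then show "(\<Sum>p | p \<in> {..<Suc N} \<and> interlaces \<kappa> (add_cell p \<mu>). b \<kappa>) =
        (card (Q \<kappa>) + (if interlaces \<kappa> \<mu> then 1 else 0)) * b \<kappa>"
      by (simp only: sum_constant lessThan_iff of_nat_id)
  qed simp
  also have "\<dots> = (\<Sum>\<kappa>\<in>K. \<Sum>p\<in>Q \<kappa>. b \<kappa>) + (\<Sum>\<kappa>\<in>K. if interlaces \<kappa> \<mu> then b \<kappa> else 0)"
    by (simp add: sum.distrib[symmetric] distrib_right if_distrib[of "\<lambda>c. c * _"] cong: if_cong)
  also have "(\<Sum>\<kappa>\<in>K. if interlaces \<kappa> \<mu> then b \<kappa> else 0) = (\<Sum>\<kappa>\<in>R. b \<kappa>)"
    by (rule sum.mono_neutral_cong_right) (use finK RK in \<open>auto simp: R_def K_def\<close>)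
  also have "(\<Sum>\<kappa>\<in>K. \<Sum>p\<in>Q \<kappa>. b \<kappa>) = (\<Sum>\<rho>\<in>R. \<Sum>p\<in>P \<rho>. b (add_cell p \<rho>))"
  proof -
    \<comment> \<open>Substitute \<open>\<rho>\<close> for \<open>\<kappa>\<close> with a cell removed from row \<open>p\<close>.\<close>
    have "(\<Sum>\<kappa>\<in>K. \<Sum>p\<in>Q \<kappa>. b \<kappa>) = (\<Sum>(\<kappa>, p)\<in>Sigma K Q. b \<kappa>)"
      by (rule sum.Sigma) (use finK in \<open>auto simp: Q_def\<close>)
    also have "\<dots> = (\<Sum>(\<rho>, p)\<in>Sigma R P. b (add_cell p \<rho>))"
    proof (rule sum.reindex_bij_witness[where
          i = "\<lambda>(\<rho>, p). (add_cell p \<rho>, p)" and j = "\<lambda>(\<kappa>, p). (remove_cell p \<kappa>, p)"])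
      fix a assume "a \<in> Sigma K Q"
      then obtain \<kappa> p where a: "a = (\<kappa>, p)" and \<kappa>: "\<kappa> \<in> shapes N"
        and p: "p < N" "0 < \<kappa> p" and inter: "interlaces (remove_cell p \<kappa>) \<mu>"
        by (auto simp: K_def Q_def)
      have undo: "add_cell p (remove_cell p \<kappa>) = \<kappa>"
        using p(2) by auto
      have "remove_cell p \<kappa> \<in> shapes N"
        using interlaces_antimono(1)[OF inter] \<kappa> by (auto simp: shapes_def)
      with inter \<kappa> p(1) undo show "(case a of (\<kappa>, p) \<Rightarrow> (remove_cell p \<kappa>, p)) \<in> Sigma R P"
        by (simp add: a R_def P_def)
      show "(case case a of (\<kappa>, p) \<Rightarrow> (remove_cell p \<kappa>, p) of (\<rho>, p) \<Rightarrow> (add_cell p \<rho>, p)) = a"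
        using undo by (simp add: a)
      show "(case case a of (\<kappa>, p) \<Rightarrow> (remove_cell p \<kappa>, p) of (\<rho>, p) \<Rightarrow> b (add_cell p \<rho>)) =
          (case a of (\<kappa>, p) \<Rightarrow> b \<kappa>)"
        using undo by (simp add: a)
    next
      fix a assume "a \<in> Sigma R P"
      then obtain \<rho> p where a: "a = (\<rho>, p)" and inter: "interlaces \<rho> \<mu>"
        and p: "p < N" "add_cell p \<rho> \<in> shapes N"
        by (auto simp: R_def P_def)
      have undo: "remove_cell p (add_cell p \<rho>) = \<rho>"
        by auto
      have "\<rho> i \<le> \<mu> i" for i
        using inter unfolding interlaces_def by blast
      then have "add_cell p \<rho> \<in> K"
        using p(2) by (auto simp: K_def le_SucI)
      with inter p(1) undo show "(case a of (\<rho>, p) \<Rightarrow> (add_cell p \<rho>, p)) \<in> Sigma K Q"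
        by (simp add: a Q_def)
      show "(case case a of (\<rho>, p) \<Rightarrow> (add_cell p \<rho>, p) of (\<kappa>, p) \<Rightarrow> (remove_cell p \<kappa>, p)) = a"
        using undo by (simp add: a)
    qed
    also have "\<dots> = (\<Sum>\<rho>\<in>R. \<Sum>p\<in>P \<rho>. b (add_cell p \<rho>))"
      by (rule sum.Sigma[symmetric]) (use finR in \<open>auto simp: P_def\<close>)
    finally show ?thesis .
  qed
  also have "(\<Sum>\<rho>\<in>R. \<Sum>p\<in>P \<rho>. b (add_cell p \<rho>)) = (\<Sum>\<rho>\<in>R. N * b \<rho>)"
    by (rule sum.cong) (simp_all add: R_def P_def b_def Suc.IH[unfolded sum_over_added_cells])
  also have "(\<Sum>\<rho>\<in>R. N * b \<rho>) + (\<Sum>\<rho>\<in>R. b \<rho>) = Suc N * (\<Sum>\<rho>\<in>R. b \<rho>)"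
    by (simp add: sum_distrib_left[symmetric])
  also have "(\<Sum>\<rho>\<in>R. b \<rho>) = card (ssyt (Suc N) \<mu>)"
    unfolding R_def b_def by (rule card_ssyt_Suc[OF Suc.prems, symmetric])
  finally show ?case .
qed

section \<open>Red fillings\<close>

definition partitions_of :: "nat \<Rightarrow> nat \<Rightarrow> (nat \<Rightarrow> nat) set" where
  "partitions_of N g = {n \<in> shapes N. (\<Sum>i<N. n i) = g}"

lemma partitions_of_le: "n \<in> partitions_of N g \<Longrightarrow> n i \<le> g"
  using member_le_sum[of i "{..<N}" n] shapes_zero[of n N i]
  by (cases "i < N") (auto simp: partitions_of_def)

lemma finite_partitions_of: "finite (partitions_of N g)"
  by (rule finite_subset[OF _ finite_bounded_shapes[of N "\<lambda>_. g"]])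
    (use partitions_of_le in \<open>auto simp: partitions_of_def\<close>)

lemma sum_add_cell:
  assumes "p < N"
  shows "(\<Sum>i<N. (add_cell p n) i) = Suc (\<Sum>i<N. n i)"
proof -
  have "(\<Sum>i<N. (add_cell p n) i) = (\<Sum>i<N. n i + (if i = p then 1 else 0))"
    by (rule sum.cong) auto
  with assms show ?thesis
    by (simp add: sum.distrib)
qed

lemma add_cell_shapes_less: "add_cell p n \<in> shapes N \<Longrightarrow> p < N"
  using shapes_zero[of "add_cell p n" N p] by (metis fun_upd_same nat.distinct(1) not_le)

text \<open>
  The red shape in a grid of \<open>r + 1\<close> rows and \<open>g\<close> columns that leaves \<open>n p\<close> blue boxes in the
  \<open>p\<close>-th row from the top. Rows of the red shape are counted from the bottom, whence the
  reversal \<open>r - i\<close>.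
\<close>

definition complement_shape :: "nat \<Rightarrow> nat \<Rightarrow> (nat \<Rightarrow> nat) \<Rightarrow> (nat \<Rightarrow> nat)" where
  "complement_shape r g n = (\<lambda>i. if i \<le> r then g - n (r - i) else 0)"

lemma complement_shape_shapes:
  assumes "n \<in> shapes M"
  shows "complement_shape r g n \<in> shapes (Suc r)"
proof -
  have "n (r - i) \<le> n (r - j)" if "i \<le> j" for i j
    using assms by (rule shapes_antimono) (use that in simp)
  then show ?thesis
    by (auto simp: shapes_def complement_shape_def antimono_def intro: diff_le_mono2)
qed

lemma inj_on_complement_shape: "inj_on (complement_shape r g) (partitions_of (Suc r) g)"
proof (rule inj_onI)
  fix n n' assume n: "n \<in> partitions_of (Suc r) g" "n' \<in> partitions_of (Suc r) g"
    and eq: "complement_shape r g n = complement_shape r g n'"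
  show "n = n'"
  proof
    fix i
    show "n i = n' i"
    proof (cases "i \<le> r")
      case True
      then have "g - n i = g - n' i"
        using fun_cong[OF eq, of "r - i"] by (simp add: complement_shape_def)
      with partitions_of_le[OF n(1), of i] partitions_of_le[OF n(2), of i] show ?thesis by simp
    next
      case False
      with n show ?thesis
        by (auto simp: partitions_of_def shapes_def)
    qed
  qed
qed

text \<open>
  The grid gains a column and the blue shape gains one cell, so every red row except the one
  beside that cell becomes longer by one box.
\<close>

lemma complement_shape_add_cell:
  assumes "n \<in> partitions_of (Suc r) g" "p \<le> r"
  shows "complement_shape r (Suc g) (add_cell p n) i =
    complement_shape r g n i + (if i \<le> r \<and> i \<noteq> r - p then 1 else 0)"
  using assms(2) partitions_of_le[OF assms(1), of "r - i"]
  by (auto simp: complement_shape_def)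

definition red_fillings :: "nat \<Rightarrow> nat \<Rightarrow> (nat \<Rightarrow> nat) \<Rightarrow> (box \<rightharpoonup> nat) set" where
  "red_fillings r g m = {T. dom T = cells m \<and> ran T \<subseteq> {1..g} \<and>
     (\<forall>i i' j a b. i < i' \<longrightarrow> T (i, j) = Some a \<longrightarrow> T (i', j) = Some b \<longrightarrow> a \<le> b) \<and>
     (\<forall>i j j' a b. j < j' \<longrightarrow> T (i, j) = Some a \<longrightarrow> T (i, j') = Some b \<longrightarrow> a < b) \<and>
     (\<forall>a\<in>{1..g}. card {x. T x = Some a} = r)}"

lemma red_fillingsD:
  assumes "T \<in> red_fillings r g m"
  shows "dom T = cells m" "ran T \<subseteq> {1..g}"
    and "T x = Some a \<Longrightarrow> 1 \<le> a \<and> a \<le> g"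
    and "i < i' \<Longrightarrow> T (i, j) = Some a \<Longrightarrow> T (i', j) = Some b \<Longrightarrow> a \<le> b"
    and "j < j' \<Longrightarrow> T (i, j) = Some a \<Longrightarrow> T (i, j') = Some b \<Longrightarrow> a < b"
    and "1 \<le> a \<Longrightarrow> a \<le> g \<Longrightarrow> card {x. T x = Some a} = r"
proof -
  have *: "dom T = cells m \<and> ran T \<subseteq> {1..g} \<and>
     (\<forall>i i' j a b. i < i' \<longrightarrow> T (i, j) = Some a \<longrightarrow> T (i', j) = Some b \<longrightarrow> a \<le> b) \<and>
     (\<forall>i j j' a b. j < j' \<longrightarrow> T (i, j) = Some a \<longrightarrow> T (i, j') = Some b \<longrightarrow> a < b) \<and>
     (\<forall>a\<in>{1..g}. card {x. T x = Some a} = r)"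
    using assms unfolding red_fillings_def by (rule CollectD)
  note c = conjunct1[OF *] conjunct1[OF conjunct2[OF *]] conjunct1[OF conjunct2[OF conjunct2[OF *]]]
    conjunct1[OF conjunct2[OF conjunct2[OF conjunct2[OF *]]]]
    conjunct2[OF conjunct2[OF conjunct2[OF conjunct2[OF *]]]]
  show "dom T = cells m" "ran T \<subseteq> {1..g}"
    by (fact c)+
  show "T x = Some a \<Longrightarrow> 1 \<le> a \<and> a \<le> g"
    using c(2) ranI[of T x a] by auto
  show "i < i' \<Longrightarrow> T (i, j) = Some a \<Longrightarrow> T (i', j) = Some b \<Longrightarrow> a \<le> b"
    by (rule c(3)[rule_format])
  show "j < j' \<Longrightarrow> T (i, j) = Some a \<Longrightarrow> T (i, j') = Some b \<Longrightarrow> a < b"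
    by (rule c(4)[rule_format])
  show "1 \<le> a \<Longrightarrow> a \<le> g \<Longrightarrow> card {x. T x = Some a} = r"
    using c(5) by simp
qed

lemma finite_red_fillings:
  assumes "m \<in> shapes M"
  shows "finite (red_fillings r g m)"
proof (rule finite_subset)
  show "red_fillings r g m \<subseteq> {T. dom T = cells m \<and> ran T \<subseteq> {1..g}}"
    using red_fillingsD(1,2) by blast
  have "finite (cells m)"
    by (rule finite_cells[of M]) (use assms in \<open>simp add: shapes_def\<close>)
  then show "finite {T. dom T = cells m \<and> ran T \<subseteq> {1..g}}"
    by (rule finite_set_of_finite_maps) simp
qed

text \<open>
  Rows increase strictly, starting from at least \<open>1\<close>. This is why a row as long as the number
  of letters contains every letter.
\<close>

lemma red_column_less_entry:
  assumes "T \<in> red_fillings r g m" "T (i, j) = Some a"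
  shows "j < a"
  using assms(2)
proof (induction j arbitrary: a)
  case 0
  then show ?case
    using red_fillingsD(3)[OF assms(1)] by fastforce
next
  case (Suc j)
  have "Suc j < m i"
    using dom_eq_cells(1)[OF red_fillingsD(1)[OF assms(1)]] Suc.prems by blast
  then obtain b where b: "T (i, j) = Some b"
    using dom_eq_cells(1)[OF red_fillingsD(1)[OF assms(1)]] Suc_lessD by blast
  have "b < a"
    using red_fillingsD(5)[OF assms(1) _ b Suc.prems] by simp
  with Suc.IH[OF b] show ?case by simp
qed

text \<open>
  The letter \<open>g + 1\<close> is the last one in every row that contains it, and by its multiplicity
  \<open>r\<close> it is absent from exactly one row \<open>i0\<close>. All other rows lose one box when it is deleted, just as
  the grid loses one column; so only the blue row beside row \<open>i0\<close> becomes shorter.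
\<close>

lemma red_fillings_remove:
  assumes n: "n \<in> partitions_of (Suc r) (Suc g)"
    and T: "T \<in> red_fillings r (Suc g) (complement_shape r (Suc g) n)"
  obtains n' p where "n' \<in> partitions_of (Suc r) g" "n = add_cell p n'"
    "below (Suc g) T \<in> red_fillings r g (complement_shape r g n')"
proof -
  define m where "m = complement_shape r (Suc g) n"
  note T = T[folded m_def]
  have shape_n: "n \<in> shapes (Suc r)"
    using n by (simp add: partitions_of_def)
  have shape_m: "m \<in> shapes (Suc r)"
    unfolding m_def by (rule complement_shape_shapes[OF shape_n])
  have m_eq: "m i = Suc g - n (r - i)" if "i \<le> r" for i
    using that by (simp add: m_def complement_shape_def)
  have dom: "(\<exists>a. T (i, j) = Some a) \<longleftrightarrow> j < m i" for i j
    by (rule dom_eq_cells(1)[OF red_fillingsD(1)[OF T]])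
  note range = red_fillingsD(3)[OF T] and col = red_fillingsD(4)[OF T]
    and row = red_fillingsD(5)[OF T]
  obtain \<kappa> where \<kappa>: "antimono \<kappa>" "dom (below (Suc g) T) = cells \<kappa>"
    and in\<kappa>: "\<And>i j. j < \<kappa> i \<longleftrightarrow> (\<exists>a<Suc g. T (i, j) = Some a)"
  proof (rule dom_below_is_cells[of T m "Suc g"])
    show "antimono m"
      using shape_m by (simp add: shapes_def)
    show "dom T = cells m"
      by (rule red_fillingsD(1)[OF T])
  qed (use col less_imp_le[OF row] in blast)+
  have \<kappa>_le: "\<kappa> i \<le> m i" for i
    using in\<kappa>[of "m i" i] dom[of i "m i"] by (auto simp: not_less)

  \<comment> \<open>The rows that contain the letter \<open>g + 1\<close>.\<close>
  define H where "H = {i. \<exists>j. T (i, j) = Some (Suc g)}"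
  have rowH: "m i = Suc (\<kappa> i)" if i: "i \<in> H" for i
  proof -
    obtain j where j: "T (i, j) = Some (Suc g)"
      using i by (auto simp: H_def)
    have "\<not> Suc j < m i"
    proof
      assume "Suc j < m i"
      then obtain b where b: "T (i, Suc j) = Some b"
        using dom by blast
      then show False
        using row[OF _ j b] range[OF b] by simp
    qed
    moreover have "j < m i"
      using j dom by blast
    moreover have "\<not> j < \<kappa> i"
      using in\<kappa>[of j i] j by auto
    moreover have "j' < \<kappa> i" if j': "j' < j" for j'
    proof -
      obtain b where b: "T (i, j') = Some b"
        using dom[of i j'] j' \<open>j < m i\<close> by auto
      show ?thesis
        using row[OF j' b j] b in\<kappa> by blast
    qed
    then have "j \<le> \<kappa> i"
      using not_less by blast
    ultimately show ?thesis by simp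
  qed
  have row_notH: "m i = \<kappa> i" if "i \<notin> H" for i
  proof -
    have "j < \<kappa> i" if j: "j < m i" for j
    proof -
      obtain b where b: "T (i, j) = Some b"
        using dom[of i j] j by auto
      with \<open>i \<notin> H\<close> have "b \<noteq> Suc g"
        by (auto simp: H_def)
      with range[OF b] have "b < Suc g" by simp
      with b in\<kappa> show ?thesis by blast
    qed
    from this[of "\<kappa> i"] \<kappa>_le[of i] show ?thesis
      by (meson le_antisym less_irrefl not_le)
  qed
  have H_le: "i \<le> r" if "i \<in> H" for i
    using rowH[OF that] shapes_zero[OF shape_m, of i] by (metis nat.distinct(1) not_less_eq_eq)

  have "H = fst ` {x. T x = Some (Suc g)}"
    by (force simp: H_def)
  moreover have "inj_on fst {x. T x = Some (Suc g)}"
  proof (rule inj_onI)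
    fix x y assume xy: "x \<in> {x. T x = Some (Suc g)}" "y \<in> {x. T x = Some (Suc g)}" "fst x = fst y"
    then obtain i j j' where ij: "x = (i, j)" "y = (i, j')"
      by (cases x; cases y) auto
    with xy have "T (i, j) = Some (Suc g)" "T (i, j') = Some (Suc g)"
      by auto
    then have "j = j'"
      using row by (metis less_irrefl linorder_neqE_nat)
    with ij show "x = y" by simp
  qed
  ultimately have "card H = r"
    using red_fillingsD(6)[OF T, of "Suc g"] by (simp add: card_image)
  moreover have "H \<subseteq> {..r}"
    using H_le by auto
  ultimately have "card ({..r} - H) = 1"
    by (simp add: card_Diff_subset finite_subset)
  then obtain i0 where i0: "{..r} - H = {i0}"
    by (auto simp: card_1_singleton_iff)
  then have i0_le: "i0 \<le> r" and i0_H: "i0 \<notin> H" and in_H: "\<And>i. i \<le> r \<Longrightarrow> i \<noteq> i0 \<Longrightarrow> i \<in> H"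
    by auto

  define p where "p = r - i0"
  have p: "p < Suc r" "r - p = i0"
    using i0_le by (auto simp: p_def)
  \<comment> \<open>A red row as long as the grid is wide would contain all letters; so row \<open>i0\<close> ends in a blue box.\<close>
  have "m i0 \<le> g"
  proof (rule ccontr)
    assume "\<not> m i0 \<le> g"
    then obtain a where a: "T (i0, g) = Some a"
      using dom[of i0 g] by auto
    with red_column_less_entry[OF T a] range[OF a] have "a = Suc g" by simp
    with a i0_H show False by (auto simp: H_def)
  qed
  then have np: "0 < n p"
    using m_eq[OF i0_le] by (cases "n p") (auto simp: p_def)
  define n' where "n' = remove_cell p n"
  have n_eq: "n = add_cell p n'"
    using np by (auto simp: n'_def)
  have sum_n': "(\<Sum>i<Suc r. n' i) = g"
    using n sum_add_cell[OF p(1), of n'] unfolding n_eq[symmetric] partitions_of_def by auto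
  have n'_le: "n' i \<le> g" if "i \<le> r" for i
    using member_le_sum[of i "{..<Suc r}" n'] that sum_n' by simp
  have \<kappa>_eq: "\<kappa> i = g - n' (r - i)" if "i \<le> r" for i
  proof (cases "i = i0")
    case True
    then show ?thesis
      using row_notH[OF i0_H] m_eq[OF that] np by (simp add: n'_def p_def)
  next
    case False
    then have "r - i \<noteq> p"
      using that i0_le by (auto simp: p_def)
    then show ?thesis
      using rowH[OF in_H[OF that False]] m_eq[OF that] by (simp add: n'_def)
  qed
  have "complement_shape r g n' = \<kappa>"
  proof
    fix i
    show "complement_shape r g n' i = \<kappa> i"
    proof (cases "i \<le> r")
      case True
      then show ?thesis
        using \<kappa>_eq by (simp add: complement_shape_def)
    next
      case False
      then have "\<kappa> i = 0"
        using \<kappa>_le[of i] shapes_zero[OF shape_m, of i] by simp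
      with False show ?thesis
        by (simp add: complement_shape_def)
    qed
  qed
  have n'_zero: "n' i = 0" if "r < i" for i
    using shapes_zero[OF shape_n, of i] that p(1) by (simp add: n'_def)
  have "antimono n'"
  proof (rule antimonoI)
    fix i j :: nat assume "i \<le> j"
    show "n' j \<le> n' i"
    proof (cases "j \<le> r")
      case True
      have "\<kappa> (r - i) \<le> \<kappa> (r - j)"
        using \<kappa>(1) \<open>i \<le> j\<close> by (simp add: antimono_def)
      then have "g - n' i \<le> g - n' j"
        using \<kappa>_eq[of "r - i"] \<kappa>_eq[of "r - j"] True \<open>i \<le> j\<close> by simp
      with n'_le[of j] n'_le[of i] True \<open>i \<le> j\<close> show ?thesis by linarith
    qed (simp add: n'_zero)
  qed
  then have "n' \<in> partitions_of (Suc r) g"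
    using n'_zero sum_n' by (simp add: partitions_of_def shapes_def)
  moreover have "below (Suc g) T \<in> red_fillings r g \<kappa>"
    unfolding red_fillings_def mem_Collect_eq below_eq_Some
  proof (intro conjI allI impI ballI)
    show "dom (below (Suc g) T) = cells \<kappa>"
      by (rule \<kappa>(2))
    show "ran (below (Suc g) T) \<subseteq> {1..g}"
      using range by (fastforce simp: ran_def below_eq_Some)
    show "card {x. T x = Some a \<and> a < Suc g} = r" if "a \<in> {1..g}" for a
      using red_fillingsD(6)[OF T, of a] that by simp
  qed (use row col in blast)+
  ultimately show ?thesis
    using that[OF _ n_eq] \<open>complement_shape r g n' = \<kappa>\<close> by simp
qed

text \<open>
  Each row except one gains a single box at its end, so the new letter \<open>g + 1\<close> occurs \<open>r\<close> times
  and never twice in a row. Columns remain weakly increasing because the new letter is the largest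
  and any box above a new one is new as well.
\<close>

lemma red_fillings_add:
  assumes n': "n' \<in> partitions_of (Suc r) g" and p: "p \<le> r"
    and T: "T \<in> red_fillings r g (complement_shape r g n')"
  shows "fill (cells (complement_shape r (Suc g) (add_cell p n'))) (Suc g) T
    \<in> red_fillings r (Suc g) (complement_shape r (Suc g) (add_cell p n'))"
proof -
  define m where "m = complement_shape r (Suc g) (add_cell p n')"
  define m' where "m' = complement_shape r g n'"
  note T = T[folded m'_def]
  have m: "m i = m' i + (if i \<le> r \<and> i \<noteq> r - p then 1 else 0)" for i
    unfolding m_def m'_def by (rule complement_shape_add_cell[OF n' p])
  have "n' \<in> shapes (Suc r)"
    using n' unfolding partitions_of_def by blast
  then have m'_antimono: "m' j \<le> m' i" if "i \<le> j" for i j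
    unfolding m'_def by (rule shapes_antimono[OF complement_shape_shapes that])
  have None: "T (i, j) = None \<longleftrightarrow> m' i \<le> j" for i j
    by (rule dom_eq_cells(2)[OF red_fillingsD(1)[OF T]])
  have sub: "dom T \<subseteq> cells m"
    unfolding red_fillingsD(1)[OF T] by (rule cells_mono) (simp add: m)
  note range = red_fillingsD(3)[OF T] and col = red_fillingsD(4)[OF T]
    and row = red_fillingsD(5)[OF T]
  have "fill (cells m) (Suc g) T \<in> red_fillings r (Suc g) m"
    unfolding red_fillings_def mem_Collect_eq fill_eq_Some[OF sub]
  proof (intro conjI allI impI ballI)
    show "dom (fill (cells m) (Suc g) T) = cells m"
      by (rule dom_fill)
    show "ran (fill (cells m) (Suc g) T) \<subseteq> {1..Suc g}"
    proof
      fix a assume "a \<in> ran (fill (cells m) (Suc g) T)"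
      then obtain x where "fill (cells m) (Suc g) T x = Some a"
        by (auto simp: ran_def)
      then have "T x = Some a \<or> a = Suc g"
        unfolding fill_eq_Some[OF sub] by blast
      then show "a \<in> {1..Suc g}"
        using range[of x a] by auto
    qed
  next
    fix i i' j a b
    assume "i < i'"
      "T (i, j) = Some a \<or> T (i, j) = None \<and> (i, j) \<in> cells m \<and> a = Suc g"
      "T (i', j) = Some b \<or> T (i', j) = None \<and> (i', j) \<in> cells m \<and> b = Suc g"
    moreover have "T (i', j) = None" if "T (i, j) = None"
      using that m'_antimono[of i i'] \<open>i < i'\<close> by (simp add: None)
    ultimately show "a \<le> b"
      using col[of i i' j a b] range[of "(i, j)" a] by (elim disjE conjE) simp_all
  next
    fix i j j' a b
    assume "j < j'"
      "T (i, j) = Some a \<or> T (i, j) = None \<and> (i, j) \<in> cells m \<and> a = Suc g"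
      "T (i, j') = Some b \<or> T (i, j') = None \<and> (i, j') \<in> cells m \<and> b = Suc g"
    moreover have "(i, j') \<notin> cells m \<and> T (i, j') = None" if "T (i, j) = None"
      using that \<open>j < j'\<close> by (simp add: None m)
    ultimately show "a < b"
      using row[of j j' i a b] range[of "(i, j)" a] by (elim disjE conjE) simp_all
  next
    fix a assume a: "a \<in> {1..Suc g}"
    show "card {x. T x = Some a \<or> T x = None \<and> x \<in> cells m \<and> a = Suc g} = r"
    proof (cases "a = Suc g")
      case False
      with a red_fillingsD(6)[OF T, of a] show ?thesis by simp
    next
      case True
      have "{x. T x = Some a \<or> T x = None \<and> x \<in> cells m \<and> a = Suc g} =
          (\<lambda>i. (i, m' i)) ` ({..r} - {r - p})"
      proof (intro set_eqI iffI)
        fix x assume "x \<in> {x. T x = Some a \<or> T x = None \<and> x \<in> cells m \<and> a = Suc g}"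
        moreover have "T x \<noteq> Some a"
          using range[of x a] True by auto
        ultimately have x: "T x = None" "x \<in> cells m" by auto
        obtain i j where ij: "x = (i, j)" by fastforce
        have "m' i \<le> j" "j < m i"
          using x None[of i j] by (simp_all add: ij)
        then have "j = m' i" "i \<le> r" "i \<noteq> r - p"
          by (auto simp: m split: if_splits)
        then show "x \<in> (\<lambda>i. (i, m' i)) ` ({..r} - {r - p})"
          by (simp add: ij)
      next
        fix x assume "x \<in> (\<lambda>i. (i, m' i)) ` ({..r} - {r - p})"
        then obtain i where "x = (i, m' i)" "i \<le> r" "i \<noteq> r - p" by auto
        then show "x \<in> {x. T x = Some a \<or> T x = None \<and> x \<in> cells m \<and> a = Suc g}"
          using True None[of i "m' i"] by (simp add: m)
      qed
      moreover have "inj_on (\<lambda>i. (i, m' i)) ({..r} - {r - p})"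
        by (auto intro: inj_onI)
      ultimately show ?thesis
        by (simp add: card_image)
    qed
  qed
  then show ?thesis
    by (simp add: m_def)
qed

lemma card_red_fillings_Suc:
  assumes n: "n \<in> partitions_of (Suc r) (Suc g)"
  shows "card (red_fillings r (Suc g) (complement_shape r (Suc g) n)) =
    (\<Sum>n' | n' \<in> partitions_of (Suc r) g \<and> (\<exists>p. n = add_cell p n').
      card (red_fillings r g (complement_shape r g n')))"
proof (rule card_by_largest_entry[where D = "cells (complement_shape r (Suc g) n)"
      and E = "\<lambda>n'. cells (complement_shape r g n')" and c = "Suc g"])
  let ?K = "{n' \<in> partitions_of (Suc r) g. \<exists>p. n = add_cell p n'}"
  have p_le: "p \<le> r" if "n = add_cell p n'" for p n'
    using n add_cell_shapes_less[of n' p "Suc r"] that by (simp add: partitions_of_def)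
  show "finite ?K"
    using finite_partitions_of by simp
  show "inj_on (\<lambda>n'. cells (complement_shape r g n')) ?K"
    using inj_on_complement_shape[of r g] by (auto simp: inj_on_def cells_inject)
  show "cells (complement_shape r g n') \<subseteq> cells (complement_shape r (Suc g) n)" if n': "n' \<in> ?K" for n'
  proof -
    obtain p where p: "n = add_cell p n'"
      using n' by blast
    show ?thesis
      by (rule cells_mono) (use n' complement_shape_add_cell[OF _ p_le[OF p]] p in simp)
  qed
  show "finite (red_fillings r g (complement_shape r g n'))" if "n' \<in> ?K" for n'
    by (rule finite_red_fillings, rule complement_shape_shapes[of _ "Suc r"])
      (use that in \<open>auto simp: partitions_of_def\<close>)
  show "dom T = cells (complement_shape r (Suc g) n) \<and> ran T \<subseteq> {..Suc g}"
    if "T \<in> red_fillings r (Suc g) (complement_shape r (Suc g) n)" for T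
    using red_fillingsD(1,2)[OF that] by auto
  show "dom T = cells (complement_shape r g n') \<and> ran T \<subseteq> {..<Suc g}"
    if "T \<in> red_fillings r g (complement_shape r g n')" for n' T
    using red_fillingsD(1,2)[OF that] by auto
  show "\<exists>n'\<in>?K. below (Suc g) T \<in> red_fillings r g (complement_shape r g n')"
    if "T \<in> red_fillings r (Suc g) (complement_shape r (Suc g) n)" for T
    using red_fillings_remove[OF n that] by blast
  show "fill (cells (complement_shape r (Suc g) n)) (Suc g) T \<in>
      red_fillings r (Suc g) (complement_shape r (Suc g) n)"
    if "n' \<in> ?K" "T \<in> red_fillings r g (complement_shape r g n')" for n' T
    using that red_fillings_add[of n' r g _ T] p_le by blast
qed

section \<open>The total number of pairs\<close>

text \<open>
  The red recursion removes a cell from \<open>n\<close>, the Pieri rule adds one to \<open>n'\<close>: after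
  interchanging the two sums, the Pieri rule evaluates the inner one.
\<close>

lemma sum_red_times_blue:
  "(\<Sum>n\<in>partitions_of (Suc r) g.
      card (red_fillings r g (complement_shape r g n)) * card (ssyt (Suc r) n)) = Suc r ^ g"
proof (induction g)
  case 0
  have "partitions_of (Suc r) 0 = {\<lambda>_. 0}"
  proof (intro set_eqI iffI)
    fix n assume "n \<in> partitions_of (Suc r) 0"
    then show "n \<in> {\<lambda>_. 0}"
      using partitions_of_le[of n "Suc r" 0] by auto
  qed (simp add: partitions_of_def shapes_def antimono_def)
  moreover have "complement_shape r 0 (\<lambda>_. 0) = (\<lambda>_. 0)"
    by (simp add: complement_shape_def fun_eq_iff)
  moreover have "red_fillings r 0 (\<lambda>_. 0) = {Map.empty}"
    by (auto simp: red_fillings_def cells_def)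
  ultimately show ?case
    by (simp add: card_ssyt_zero_shape)
next
  case (Suc g)
  define R where "R g n = card (red_fillings r g (complement_shape r g n))" for g n
  define b where "b n = card (ssyt (Suc r) n)" for n
  have "(\<Sum>n\<in>partitions_of (Suc r) (Suc g). R (Suc g) n * b n) =
      (\<Sum>n\<in>partitions_of (Suc r) (Suc g).
        \<Sum>n' | n' \<in> partitions_of (Suc r) g \<and> (\<exists>p. n = add_cell p n'). R g n' * b n)"
    unfolding R_def by (rule sum.cong) (simp_all add: card_red_fillings_Suc sum_distrib_right)
  also have "\<dots> = (\<Sum>n'\<in>partitions_of (Suc r) g.
      \<Sum>n | n \<in> partitions_of (Suc r) (Suc g) \<and> (\<exists>p. n = add_cell p n'). R g n' * b n)"
    by (rule sum.swap_restrict) (rule finite_partitions_of)+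
  also have "\<dots> = (\<Sum>n'\<in>partitions_of (Suc r) g. R g n' * (Suc r * b n'))"
  proof (rule sum.cong)
    fix n' assume n': "n' \<in> partitions_of (Suc r) g"
    have "{n. n \<in> partitions_of (Suc r) (Suc g) \<and> (\<exists>p. n = add_cell p n')} =
        {n. n \<in> shapes (Suc r) \<and> (\<exists>p. n = add_cell p n')}"
    proof (intro set_eqI iffI)
      fix n assume "n \<in> {n. n \<in> shapes (Suc r) \<and> (\<exists>p. n = add_cell p n')}"
      then obtain p where p: "n \<in> shapes (Suc r)" "n = add_cell p n'" by blast
      then have "(\<Sum>i<Suc r. n i) = Suc g"
        using sum_add_cell[OF add_cell_shapes_less, of n' p "Suc r"] n' unfolding partitions_of_def by auto
      with p show "n \<in> {n. n \<in> partitions_of (Suc r) (Suc g) \<and> (\<exists>p. n = add_cell p n')}"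
        unfolding partitions_of_def by blast
    qed (auto simp: partitions_of_def)
    moreover have "(\<Sum>n | n \<in> shapes (Suc r) \<and> (\<exists>p. n = add_cell p n'). b n) = Suc r * b n'"
      unfolding b_def by (rule pieri_single_cell) (use n' in \<open>simp add: partitions_of_def\<close>)
    ultimately show "(\<Sum>n | n \<in> partitions_of (Suc r) (Suc g) \<and> (\<exists>p. n = add_cell p n'). R g n' * b n) =
        R g n' * (Suc r * b n')"
      by (simp only: sum_distrib_left[symmetric])
  qed simp
  also have "\<dots> = Suc r * (\<Sum>n'\<in>partitions_of (Suc r) g. R g n' * b n')"
    unfolding sum_distrib_left by (rule sum.cong) (simp_all add: algebra_simps)
  also have "\<dots> = Suc r ^ Suc g"
    unfolding R_def b_def Suc.IH by simp
  finally show ?case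
    by (simp add: R_def b_def)
qed

section \<open>Separating the colours\<close>

lemma young_diagram_iff_cells:
  "(\<exists>ps. is_partition ps \<and> S = young_diagram ps) \<longleftrightarrow> (\<exists>N. \<exists>\<mu>\<in>shapes N. S = cells \<mu>)"
proof
  assume "\<exists>ps. is_partition ps \<and> S = young_diagram ps"
  then obtain ps where ps: "is_partition ps" "S = young_diagram ps" by blast
  define \<mu> where "\<mu> i = (if i < length ps then ps ! i else 0)" for i
  have "\<mu> j \<le> \<mu> i" if "i \<le> j" for i j
    using ps(1) that sorted_wrt_nth_less[of "(\<ge>)" ps i j]
    by (cases "i = j") (auto simp: \<mu>_def is_partition_def)
  then have "\<mu> \<in> shapes (length ps)"
    by (simp add: shapes_def antimono_def \<mu>_def)
  moreover have "S = cells \<mu>"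
    by (auto simp: ps(2) young_diagram_def cells_def \<mu>_def split: if_splits)
  ultimately show "\<exists>N. \<exists>\<mu>\<in>shapes N. S = cells \<mu>" by blast
next
  assume "\<exists>N. \<exists>\<mu>\<in>shapes N. S = cells \<mu>"
  then obtain N \<mu> where \<mu>: "\<mu> \<in> shapes N" and S: "S = cells \<mu>" by blast
  define k where "k = (LEAST i. \<mu> i = 0)"
  have "\<mu> k = 0"
    unfolding k_def by (rule LeastI[of _ N]) (rule shapes_zero[OF \<mu> order_refl])
  have k: "0 < \<mu> i \<longleftrightarrow> i < k" for i
  proof
    show "i < k" if "0 < \<mu> i"
      using shapes_antimono[OF \<mu>, of k i] \<open>\<mu> k = 0\<close> that by (metis le_zero_eq not_le less_irrefl)
    show "0 < \<mu> i" if "i < k"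
      using not_less_Least[OF that[unfolded k_def]] by simp
  qed
  define ps where "ps = map \<mu> [0..<k]"
  have "is_partition ps"
    unfolding is_partition_def
  proof
    show "sorted_wrt (\<ge>) ps"
      unfolding sorted_wrt_iff_nth_less using shapes_antimono[OF \<mu>]
      by (auto simp: ps_def intro: less_imp_le)
    show "0 \<notin> set ps"
    proof
      assume "0 \<in> set ps"
      then obtain i where "i < k" "\<mu> i = 0"
        by (auto simp: ps_def)
      with k[of i] show False by simp
    qed
  qed
  moreover have "cells \<mu> = young_diagram ps"
  proof -
    have "j < \<mu> i \<longleftrightarrow> i < length ps \<and> j < ps ! i" for i j
      using k[of i] by (cases "i < k") (auto simp: ps_def)
    then show ?thesis
      by (simp add: young_diagram_def cells_def)
  qed
  ultimately show "\<exists>ps. is_partition ps \<and> S = young_diagram ps"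
    using S by blast
qed

definition red_part :: "(box \<rightharpoonup> entry) \<Rightarrow> (box \<rightharpoonup> nat)" where
  "red_part T = (\<lambda>x. case T x of Some (Red a) \<Rightarrow> Some a | _ \<Rightarrow> None)"

text \<open>
  A half turn of the grid combined with \<open>a \<mapsto> r - a\<close> reverses both the order of the boxes and the
  order of the entries. So strict columns and weak rows are preserved, while the blue region
  moves into the lower left corner and becomes a Young diagram.
\<close>

definition blue_part :: "nat \<Rightarrow> nat \<Rightarrow> (box \<rightharpoonup> entry) \<Rightarrow> (box \<rightharpoonup> nat)" where
  "blue_part r g T = (\<lambda>(p, q). if p \<le> r \<and> q < g
     then case T (r - p, g - 1 - q) of Some (Blue a) \<Rightarrow> Some (r - a) | _ \<Rightarrow> None else None)"

definition assemble :: "nat \<Rightarrow> nat \<Rightarrow> (box \<rightharpoonup> nat) \<Rightarrow> (box \<rightharpoonup> nat) \<Rightarrow> (box \<rightharpoonup> entry)" where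
  "assemble r g R B = (\<lambda>(i, j). if i \<le> r \<and> j < g
     then case R (i, j) of Some a \<Rightarrow> Some (Red a)
       | None \<Rightarrow> map_option (\<lambda>a. Blue (r - a)) (B (r - i, g - 1 - j)) else None)"

lemma red_part_eq_Some: "red_part T x = Some a \<longleftrightarrow> T x = Some (Red a)"
  by (auto simp: red_part_def split: option.splits entry.splits)

lemma blue_part_eq_Some: "blue_part r g T (p, q) = Some a \<longleftrightarrow>
    p \<le> r \<and> q < g \<and> (\<exists>c. T (r - p, g - 1 - q) = Some (Blue c) \<and> a = r - c)"
  by (auto simp: blue_part_def split: option.splits entry.splits)

lemma L_tableauD:
  assumes "T \<in> L_tableaux g r (g + r)"
  shows "T (i, j) = None \<longleftrightarrow> \<not> (i \<le> r \<and> j < g)"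
    and "\<exists>ps. is_partition ps \<and> red_boxes T = young_diagram ps"
    and "i < i' \<Longrightarrow> T (i, j) = Some (Red a) \<Longrightarrow> T (i', j) = Some (Red b) \<Longrightarrow> a \<le> b"
    and "j < j' \<Longrightarrow> T (i, j) = Some (Red a) \<Longrightarrow> T (i, j') = Some (Red b) \<Longrightarrow> a < b"
    and "T x = Some (Red a) \<Longrightarrow> 1 \<le> a \<and> a \<le> g"
    and "1 \<le> a \<Longrightarrow> a \<le> g \<Longrightarrow> card {x. T x = Some (Red a)} = r"
    and "T x = Some (Blue a) \<Longrightarrow> a \<le> r"
    and "i < i' \<Longrightarrow> T (i, j) = Some (Blue a) \<Longrightarrow> T (i', j) = Some (Blue b) \<Longrightarrow> a < b"
    and "j < j' \<Longrightarrow> T (i, j) = Some (Blue a) \<Longrightarrow> T (i, j') = Some (Blue b) \<Longrightarrow> a \<le> b"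
proof -
  have *: "is_L_tableau g r (g + r) T"
    using assms by (simp add: L_tableaux_def)
  note c1 = *[unfolded is_L_tableau_def]
  note c2 = conjunct2[OF c1] note c3 = conjunct2[OF c2] note c4 = conjunct2[OF c3]
  note c5 = conjunct2[OF c4] note c6 = conjunct2[OF c5] note c7 = conjunct2[OF c6]
  note c8 = conjunct2[OF c7] note c9 = conjunct2[OF c8]
  have "(i, j) \<in> dom T \<longleftrightarrow> i \<le> r \<and> j < g"
    unfolding conjunct1[OF c1] grid_def by auto
  then show "T (i, j) = None \<longleftrightarrow> \<not> (i \<le> r \<and> j < g)"
    unfolding domIff by blast
  show "\<exists>ps. is_partition ps \<and> red_boxes T = young_diagram ps"
    by (rule conjunct1[OF c2])
  show "i < i' \<Longrightarrow> T (i, j) = Some (Red a) \<Longrightarrow> T (i', j) = Some (Red b) \<Longrightarrow> a \<le> b"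
    by (rule conjunct1[OF c3, rule_format])
  show "j < j' \<Longrightarrow> T (i, j) = Some (Red a) \<Longrightarrow> T (i, j') = Some (Red b) \<Longrightarrow> a < b"
    by (rule conjunct1[OF c4, rule_format])
  show "T x = Some (Red a) \<Longrightarrow> 1 \<le> a \<and> a \<le> g"
    using conjunct1[OF c5, rule_format, of x a] by simp
  show "1 \<le> a \<Longrightarrow> a \<le> g \<Longrightarrow> card {x. T x = Some (Red a)} = r"
    using conjunct1[OF c6, rule_format, of a] by simp
  show "T x = Some (Blue a) \<Longrightarrow> a \<le> r"
    using conjunct1[OF c7, rule_format, of x a] by simp
  show "i < i' \<Longrightarrow> T (i, j) = Some (Blue a) \<Longrightarrow> T (i', j) = Some (Blue b) \<Longrightarrow> a < b"
    by (rule conjunct1[OF c8, rule_format])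
  show "j < j' \<Longrightarrow> T (i, j) = Some (Blue a) \<Longrightarrow> T (i, j') = Some (Blue b) \<Longrightarrow> a \<le> b"
    by (rule c9[rule_format])
qed

lemma assemble_parts:
  assumes "T \<in> L_tableaux g r (g + r)"
  shows "assemble r g (red_part T) (blue_part r g T) = T"
proof
  fix x :: box
  obtain i j where x: "x = (i, j)" by fastforce
  show "assemble r g (red_part T) (blue_part r g T) x = T x"
  proof (cases "T x")
    case None
    then show ?thesis
      using L_tableauD(1)[OF assms, of i j] by (auto simp: assemble_def x)
  next
    case (Some e)
    then have in_grid: "i \<le> r" "j < g"
      using L_tableauD(1)[OF assms, of i j] by (auto simp: x)
    show ?thesis
    proof (cases e)
      case (Red a)
      with Some have "red_part T (i, j) = Some a"
        by (simp add: red_part_eq_Some x)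
      with in_grid Some Red show ?thesis
        by (simp add: assemble_def x)
    next
      case (Blue a)
      have "red_part T (i, j) = None"
        using Some by (simp add: red_part_def x Blue)
      moreover have "blue_part r g T (r - i, g - 1 - j) = Some (r - a)"
        unfolding blue_part_eq_Some using Some in_grid by (auto simp: x Blue)
      moreover have "r - (r - a) = a"
        using L_tableauD(7)[OF assms] Some Blue by auto
      ultimately show ?thesis
        using Some in_grid by (simp add: assemble_def x Blue)
    qed
  qed
qed

text \<open>
  The blue shape has \<open>g\<close> cells because the \<open>g\<close> red letters, each used \<open>r\<close> times, fill
  \<open>r g\<close> of the \<open>(r + 1) g\<close> boxes.
\<close>

lemma parts_of_L_tableau:
  assumes T: "T \<in> L_tableaux g r (g + r)"
  obtains n where "n \<in> partitions_of (Suc r) g"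
    "red_part T \<in> red_fillings r g (complement_shape r g n)"
    "blue_part r g T \<in> ssyt (Suc r) n"
proof -
  note None = L_tableauD(1)[OF T]
  obtain M m where m: "m \<in> shapes M" and "red_boxes T = cells m"
    using L_tableauD(2)[OF T, unfolded young_diagram_iff_cells] by blast
  then have red: "(\<exists>a. T (i, j) = Some (Red a)) \<longleftrightarrow> j < m i" for i j
    unfolding red_boxes_def set_eq_iff mem_Collect_eq by (metis cells_iff)
  have m_zero: "m i = 0" if "r < i" for i
    using red[where i = i and j = 0] None[of i 0] that by auto
  have m_le: "m i \<le> g" for i
  proof (rule ccontr)
    assume "\<not> m i \<le> g"
    then have "\<exists>a. T (i, g) = Some (Red a)"
      using red by simp
    with None[of i g] show False by auto
  qed
  have m_antimono: "m j \<le> m i" if "i \<le> j" for i j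
    by (rule shapes_antimono[OF m that])
  define n where "n p = (if p \<le> r then g - m (r - p) else 0)" for p
  have "antimono n"
    by (rule antimonoI) (auto simp: n_def intro: diff_le_mono2 m_antimono)
  then have n_shape: "n \<in> shapes (Suc r)"
    by (simp add: shapes_def n_def)
  have m_eq: "complement_shape r g n = m"
    using m_le m_zero by (auto simp: complement_shape_def n_def)

  have "{x. \<exists>a. T x = Some (Red a)} = (\<Union>a\<in>{1..g}. {x. T x = Some (Red a)})"
    using L_tableauD(5)[OF T] by fastforce
  moreover have "cells m = {x. \<exists>a. T x = Some (Red a)}"
    using \<open>red_boxes T = cells m\<close> by (simp add: red_boxes_def)
  ultimately have cells_m: "cells m = (\<Union>a\<in>{1..g}. {x. T x = Some (Red a)})"
    by simp
  have "finite (cells m)"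
    by (rule finite_cells[of "Suc r"]) (simp add: m_zero)
  have "finite {x. T x = Some (Red a)}" if a: "a \<in> {1..g}" for a
    by (rule finite_subset[OF _ \<open>finite (cells m)\<close>]) (use a in \<open>auto simp: cells_m\<close>)
  then have "card (cells m) = (\<Sum>a\<in>{1..g}. card {x. T x = Some (Red a)})"
    unfolding cells_m by (intro card_UN_disjoint) auto
  also have "\<dots> = (\<Sum>a\<in>{1..g}. r)"
    by (rule sum.cong) (simp_all add: L_tableauD(6)[OF T])
  finally have "(\<Sum>i<Suc r. m i) = g * r"
    using card_cells[of "Suc r" m] m_zero by simp
  moreover have "(\<Sum>i<Suc r. m (Suc r - Suc i)) = (\<Sum>i<Suc r. m i)"
    by (rule sum.nat_diff_reindex)
  moreover have "(\<Sum>p<Suc r. n p) + (\<Sum>i<Suc r. m (Suc r - Suc i)) = (\<Sum>p<Suc r. g)"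
    unfolding sum.distrib[symmetric] by (rule sum.cong) (auto simp: n_def m_le)
  ultimately have "(\<Sum>p<Suc r. n p) = g"
    by (simp only: sum_constant card_lessThan) (simp add: mult.commute)
  with n_shape have "n \<in> partitions_of (Suc r) g"
    unfolding partitions_of_def by blast

  moreover have "red_part T \<in> red_fillings r g m"
    unfolding red_fillings_def mem_Collect_eq red_part_eq_Some
  proof (intro conjI allI impI ballI)
    show "dom (red_part T) = cells m"
      unfolding \<open>cells m = {x. \<exists>a. T x = Some (Red a)}\<close> dom_def by (auto simp: red_part_eq_Some)
    show "ran (red_part T) \<subseteq> {1..g}"
      using L_tableauD(5)[OF T] by (force simp: ran_def red_part_eq_Some)
    show "card {x. T x = Some (Red a)} = r" if "a \<in> {1..g}" for a
      using L_tableauD(6)[OF T] that by simp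
  qed (use L_tableauD(3,4)[OF T] in blast)+

  moreover have "blue_part r g T \<in> ssyt (Suc r) n"
    unfolding ssyt_def mem_Collect_eq
  proof (intro conjI allI impI)
    show "dom (blue_part r g T) = cells n"
    proof (rule set_eqI)
      fix x :: box
      obtain p q where x: "x = (p, q)" by fastforce
      have blue: "(\<exists>c. T (i, j) = Some (Blue c)) \<longleftrightarrow> i \<le> r \<and> j < g \<and> \<not> j < m i" for i j
        unfolding red[symmetric] using None[of i j] by (cases "T (i, j)"; cases "the (T (i, j))") auto
      have "x \<in> dom (blue_part r g T) \<longleftrightarrow> p \<le> r \<and> q < g \<and> (\<exists>c. T (r - p, g - 1 - q) = Some (Blue c))"
        unfolding x dom_def mem_Collect_eq not_None_eq blue_part_eq_Some by blast
      also have "\<dots> \<longleftrightarrow> q < n p"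
        unfolding blue n_def by auto
      finally show "x \<in> dom (blue_part r g T) \<longleftrightarrow> x \<in> cells n"
        by (simp add: x)
    qed
    show "ran (blue_part r g T) \<subseteq> {..<Suc r}"
      by (auto simp: ran_def blue_part_eq_Some)
  next
    fix p p' q a b
    assume "p < p'" "blue_part r g T (p, q) = Some a" "blue_part r g T (p', q) = Some b"
    then obtain c d where "T (r - p, g - 1 - q) = Some (Blue c)" "a = r - c"
      and "T (r - p', g - 1 - q) = Some (Blue d)" "b = r - d" and "r - p' < r - p"
      unfolding blue_part_eq_Some by auto
    moreover from this have "d < c" "c \<le> r"
      using L_tableauD(7,8)[OF T] by blast+
    ultimately show "a < b"
      by simp
  next
    fix p q q' a b
    assume "q < q'" "blue_part r g T (p, q) = Some a" "blue_part r g T (p, q') = Some b"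
    then obtain c d where "T (r - p, g - 1 - q) = Some (Blue c)" "a = r - c"
      and "T (r - p, g - 1 - q') = Some (Blue d)" "b = r - d" and "g - 1 - q' < g - 1 - q"
      unfolding blue_part_eq_Some by auto
    moreover from this have "d \<le> c"
      using L_tableauD(9)[OF T] by blast
    ultimately show "a \<le> b"
      by simp
  qed
  ultimately show ?thesis
    by (rule that[of n, unfolded m_eq])
qed

lemma L_tableau_of_parts:
  assumes n: "n \<in> partitions_of (Suc r) g"
    and R: "R \<in> red_fillings r g (complement_shape r g n)"
    and B: "B \<in> ssyt (Suc r) n"
  shows "assemble r g R B \<in> L_tableaux g r (g + r)"
    and "red_part (assemble r g R B) = R"
    and "blue_part r g (assemble r g R B) = B"
proof -
  define T where "T = assemble r g R B"
  have domR: "R (i, j) = None \<longleftrightarrow> complement_shape r g n i \<le> j" for i j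
    by (rule dom_eq_cells(2)[OF red_fillingsD(1)[OF R]])
  have domB: "B (p, q) = None \<longleftrightarrow> n p \<le> q" for p q
    by (rule dom_eq_cells(2)[OF ssytD(1)[OF B]])
  have n_le: "n p \<le> g" for p
    by (rule partitions_of_le[OF n])
  have n_zero: "n p = 0" if "r < p" for p
    using n that by (simp add: partitions_of_def shapes_def)
  have R_grid: "i \<le> r" "j < g" if "R (i, j) \<noteq> None" for i j
    using that by (auto simp: domR complement_shape_def split: if_splits)
  have R_iff_B: "R (i, j) = None \<longleftrightarrow> B (r - i, g - 1 - j) \<noteq> None" if "i \<le> r" "j < g" for i j
    using that n_le[of "r - i"] by (auto simp: domR domB complement_shape_def)
  have red: "T (i, j) = Some (Red a) \<longleftrightarrow> R (i, j) = Some a" for i j a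
    using R_grid[of i j] by (auto simp: T_def assemble_def split: option.splits)
  have blue: "T (i, j) = Some (Blue c) \<longleftrightarrow>
      i \<le> r \<and> j < g \<and> (\<exists>b. B (r - i, g - 1 - j) = Some b \<and> c = r - b)" for i j c
    using R_iff_B[of i j] by (auto simp: T_def assemble_def split: option.splits)
  have T_None: "T (i, j) = None \<longleftrightarrow> \<not> (i \<le> r \<and> j < g)" for i j
    using R_iff_B[of i j] by (auto simp: T_def assemble_def split: option.splits)
  have red': "T x = Some (Red a) \<longleftrightarrow> R x = Some a" for x a
    using red by (cases x) auto

  have "is_L_tableau g r (g + r) T"
    unfolding is_L_tableau_def red'
  proof (intro conjI allI impI ballI)
    have "(i, j) \<in> dom T \<longleftrightarrow> i \<le> r \<and> j < g" for i j
      unfolding domIff using T_None[of i j] by simp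
    then show "dom T = grid r (g + r)"
      unfolding grid_def set_eq_iff by (simp add: split_paired_all less_Suc_eq_le del: domIff)
    have "red_boxes T = cells (complement_shape r g n)"
      unfolding red_fillingsD(1)[OF R, symmetric] red_boxes_def red' by (auto simp: dom_def)
    moreover have "complement_shape r g n \<in> shapes (Suc r)"
      by (rule complement_shape_shapes[of n "Suc r"]) (use n in \<open>simp add: partitions_of_def\<close>)
    ultimately show "\<exists>ps. is_partition ps \<and> red_boxes T = young_diagram ps"
      unfolding young_diagram_iff_cells by blast
    show "a \<in> {1..g}" if "R x = Some a" for x a
      using red_fillingsD(3)[OF R that] by simp
    show "card {x. R x = Some a} = r" if "a \<in> {1..g}" for a
      using red_fillingsD(6)[OF R] that by simp
    show "a \<in> {0..r}" if "T x = Some (Blue a)" for x a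
      using that blue[of "fst x" "snd x" a] by (simp; elim conjE exE) simp
  next
    fix i i' j a b
    assume *: "i < i'" "T (i, j) = Some (Blue a)" "T (i', j) = Some (Blue b)"
    then obtain c d where c: "B (r - i, g - 1 - j) = Some c" "a = r - c"
      and d: "B (r - i', g - 1 - j) = Some d" "b = r - d" and "r - i' < r - i"
      unfolding blue by auto
    then have "d < c" "c < Suc r"
      using ssytD(3,4)[OF B] by blast+
    with c(2) d(2) show "a < b" by simp
  next
    fix i j j' a b
    assume *: "j < j'" "T (i, j) = Some (Blue a)" "T (i, j') = Some (Blue b)"
    then obtain c d where c: "B (r - i, g - 1 - j) = Some c" "a = r - c"
      and d: "B (r - i, g - 1 - j') = Some d" "b = r - d" and "g - 1 - j' < g - 1 - j"
      unfolding blue by auto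
    then have "d \<le> c"
      using ssytD(5)[OF B] by blast
    with c(2) d(2) show "a \<le> b" by simp
  qed (use red_fillingsD(4,5)[OF R] in blast)+
  then show "assemble r g R B \<in> L_tableaux g r (g + r)"
    by (simp add: T_def L_tableaux_def)

  have "red_part T x = R x" for x
    using red'[of x] red_part_eq_Some[of T x] by (metis option.exhaust)
  then show "red_part (assemble r g R B) = R"
    by (auto simp: T_def)

  have "blue_part r g T (p, q) = B (p, q)" for p q
  proof (cases "B (p, q)")
    case None
    have False if c: "p \<le> r" "q < g" "T (r - p, g - 1 - q) = Some (Blue c)" for c
      using c None by (auto simp: blue)
    then show ?thesis
      using None by (cases "blue_part r g T (p, q)") (auto simp: blue_part_eq_Some)
  next
    case (Some b)
    have "q < n p"
      using domB[of p q] Some by simp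
    then have pq: "p \<le> r" "q < g"
      using n_zero[of p] n_le[of p] by (cases "p \<le> r"; simp)+
    have "b \<le> r"
      using ssytD(3)[OF B Some] by simp
    then have "T (r - p, g - 1 - q) = Some (Blue (r - b)) \<and> b = r - (r - b)"
      using pq Some by (auto simp: blue)
    with pq have "blue_part r g T (p, q) = Some b"
      unfolding blue_part_eq_Some by blast
    with Some show ?thesis by simp
  qed
  then show "blue_part r g (assemble r g R B) = B"
    by (auto simp: T_def)
qed

lemma finite_card_L_tableaux:
  "finite (L_tableaux g r (g + r)) \<and> card (L_tableaux g r (g + r)) = Suc r ^ g"
proof -
  define U where "U n = red_fillings r g (complement_shape r g n) \<times> ssyt (Suc r) n" for n
  let ?P = "partitions_of (Suc r) g"
  have bij: "bij_betw (\<lambda>T. (red_part T, blue_part r g T)) (L_tableaux g r (g + r)) (\<Union>n\<in>?P. U n)"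
  proof (rule bij_betw_byWitness[where f' = "\<lambda>(R, B). assemble r g R B"])
    show "\<forall>T\<in>L_tableaux g r (g + r). (\<lambda>(R, B). assemble r g R B) (red_part T, blue_part r g T) = T"
      by (simp add: assemble_parts)
    show "\<forall>x\<in>\<Union>n\<in>?P. U n. (\<lambda>T. (red_part T, blue_part r g T)) ((\<lambda>(R, B). assemble r g R B) x) = x"
    proof
      fix x assume "x \<in> (\<Union>n\<in>?P. U n)"
      then obtain n R B where "n \<in> ?P" "x = (R, B)"
        and "R \<in> red_fillings r g (complement_shape r g n)" "B \<in> ssyt (Suc r) n"
        by (auto simp: U_def)
      then show "(\<lambda>T. (red_part T, blue_part r g T)) ((\<lambda>(R, B). assemble r g R B) x) = x"
        using L_tableau_of_parts(2,3)[of n r g R B] by simp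
    qed
    show "(\<lambda>T. (red_part T, blue_part r g T)) ` L_tableaux g r (g + r) \<subseteq> (\<Union>n\<in>?P. U n)"
    proof (rule image_subsetI)
      fix T assume "T \<in> L_tableaux g r (g + r)"
      then show "(red_part T, blue_part r g T) \<in> (\<Union>n\<in>?P. U n)"
        by (rule parts_of_L_tableau) (auto simp: U_def)
    qed
    show "(\<lambda>(R, B). assemble r g R B) ` (\<Union>n\<in>?P. U n) \<subseteq> L_tableaux g r (g + r)"
    proof (rule image_subsetI)
      fix x assume "x \<in> (\<Union>n\<in>?P. U n)"
      then obtain n R B where "n \<in> ?P" "x = (R, B)"
        and "R \<in> red_fillings r g (complement_shape r g n)" "B \<in> ssyt (Suc r) n"
        by (auto simp: U_def)
      then show "(\<lambda>(R, B). assemble r g R B) x \<in> L_tableaux g r (g + r)"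
        using L_tableau_of_parts(1)[of n r g R B] by simp
    qed
  qed
  have finU: "finite (U n)" if "n \<in> ?P" for n
  proof -
    have "n \<in> shapes (Suc r)"
      using that unfolding partitions_of_def by blast
    then show ?thesis
      unfolding U_def
      by (intro finite_cartesian_product finite_red_fillings[OF complement_shape_shapes] finite_ssyt)
  qed
  have "card (\<Union>n\<in>?P. U n) = (\<Sum>n\<in>?P. card (U n))"
  proof (rule card_UN_disjoint)
    show "\<forall>n\<in>?P. \<forall>n'\<in>?P. n \<noteq> n' \<longrightarrow> U n \<inter> U n' = {}"
    proof (intro ballI impI)
      fix n n' :: "nat \<Rightarrow> nat" assume "n \<noteq> n'"
      then have "ssyt (Suc r) n \<inter> ssyt (Suc r) n' = {}"
        using ssytD(1) cells_inject by (metis disjoint_iff)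
      then show "U n \<inter> U n' = {}"
        by (auto simp: U_def)
    qed
  qed (use finU finite_partitions_of in auto)
  also have "\<dots> = Suc r ^ g"
    unfolding U_def card_cartesian_product by (rule sum_red_times_blue)
  finally have "card (L_tableaux g r (g + r)) = Suc r ^ g"
    using bij_betw_same_card[OF bij] by simp
  moreover have "finite (\<Union>n\<in>?P. U n)"
    using finU finite_partitions_of by blast
  then have "finite (L_tableaux g r (g + r))"
    using bij_betw_finite[OF bij] by simp
  ultimately show ?thesis by blast
qed

theorem proposition3p16:
  fixes g r :: nat
  assumes "r \<ge> 1"
  shows "\<exists>f. bij_betw f (L_tableaux g r (g + r)) (words r g)"
proof -
  have "words r g = {w. set w \<subseteq> {0..r} \<and> length w = g}"
    by (auto simp: words_def)
  then have "finite (words r g)" "card (words r g) = Suc r ^ g"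
    using finite_lists_length_eq[of "{0..r}" g] card_lists_length_eq[of "{0..r}" g] by simp_all
  then show ?thesis
    using finite_card_L_tableaux[of g r] by (intro finite_same_card_bij) simp_all
qed

end
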